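(* The 3-periodic family of the elliptic billiard is the image of the Poristic family under a one-parameter family of similarity transformations. Precisely: let $R\ge 2r>0$, $d=\sqrt{R(R-2r)}$, and let $\Delta(t)$, $t\in\mathbb{R}$, be the Poristic family with circumradius $R$ and inradius $r$. Then there exist an ellipse $E$ and a family of similarity transformations $S_t$ of the plane, $t\in\mathbb{R}$ (each a composition of a rotation, a translation and a uniform dilation), such that the set of triangles $\{S_t(\Delta(t)) : t\in\mathbb{R}\}$ is exactly the set of all 3-periodics of the elliptic billiard $E$.
   Context: Poristic family: fix in the plane a circle (the circumcircle) with center $X_3=(0,0)$ and radius $R$ and a circle (the incircle) with center $X_1=(d,0)$ and radius $r$, where $d=\sqrt{R(R-2r)}$. The Poristic family is the family of all triangles having these two circles as circumcircle and incircle. It is parametrized by $t\in\mathbb{R}$: $\Delta(t)$ is the unique triangle of the family having a side tangent to the incircle at the point $X_1+r(\cos t,\sin t)$. A 3-periodic of the elliptic billiard $E$ ($E$ an ellipse, possibly a circle) is a triangle inscribed in $E$ such that at each vertex the normal line to $E$ bisects the interior angle of the triangle (i.e. a closed billiard trajectory with three bounces). The 3-periodic family of $E$ is the set of all such triangles. *)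

theory Defs
  imports "HOL-Analysis.Analysis"
begin

text \<open>A triangle is represented by its set of vertices.\<close>

definition is_triangle :: "(real^2) set \<Rightarrow> bool" where
  "is_triangle T \<longleftrightarrow> card T = 3 \<and> \<not> collinear T"

definition side_lines :: "(real^2) set \<Rightarrow> (real^2) set set" where
  "side_lines T = {affine hull {A, B} | A B. A \<in> T \<and> B \<in> T \<and> A \<noteq> B}"

definition tangent_to_circle_at :: "(real^2) set \<Rightarrow> real^2 \<Rightarrow> real \<Rightarrow> real^2 \<Rightarrow> bool" where
  "tangent_to_circle_at L c \<rho> P \<longleftrightarrow> L \<inter> sphere c \<rho> = {P}"

definition has_circumcircle :: "(real^2) set \<Rightarrow> real^2 \<Rightarrow> real \<Rightarrow> bool" where
  "has_circumcircle T c \<rho> \<longleftrightarrow> T \<subseteq> sphere c \<rho>"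

text \<open>Containment of the disk in the triangle excludes the excircles, which are also tangent to
  the three side lines.\<close>

definition has_incircle :: "(real^2) set \<Rightarrow> real^2 \<Rightarrow> real \<Rightarrow> bool" where
  "has_incircle T c \<rho> \<longleftrightarrow>
     cball c \<rho> \<subseteq> convex hull T \<and> (\<forall>L\<in>side_lines T. \<exists>P. tangent_to_circle_at L c \<rho> P)"

definition poristic_incenter :: "real \<Rightarrow> real \<Rightarrow> real^2" where
  "poristic_incenter R r = vector [sqrt (R * (R - 2 * r)), 0]"

definition poristic_family :: "real \<Rightarrow> real \<Rightarrow> (real^2) set set" where
  "poristic_family R r =
     {T. is_triangle T \<and> has_circumcircle T 0 R \<and> has_incircle T (poristic_incenter R r) r}"

definition poristic_triangle :: "real \<Rightarrow> real \<Rightarrow> real \<Rightarrow> (real^2) set" where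
  "poristic_triangle R r t =
     (THE T. T \<in> poristic_family R r \<and>
        (\<exists>L\<in>side_lines T. tangent_to_circle_at L (poristic_incenter R r) r
           (poristic_incenter R r + r *\<^sub>R vector [cos t, sin t])))"

text \<open>An ellipse in arbitrary position: the standard equation in an orthonormal frame
  \<open>u, v\<close> centred at \<open>c\<close>. Circles are included as the case \<open>a = b\<close>.\<close>

definition is_ellipse :: "(real^2) set \<Rightarrow> bool" where
  "is_ellipse E \<longleftrightarrow> (\<exists>c u v a b. a > 0 \<and> b > 0 \<and> norm u = 1 \<and> norm v = 1 \<and> u \<bullet> v = 0 \<and>
     E = {X. (((X - c) \<bullet> u) / a)\<^sup>2 + (((X - c) \<bullet> v) / b)\<^sup>2 = 1})"

definition tangent_vector :: "(real^2) set \<Rightarrow> real^2 \<Rightarrow> real^2 \<Rightarrow> bool" where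
  "tangent_vector E P w \<longleftrightarrow> (\<exists>\<gamma>::real \<Rightarrow> real^2. \<gamma> 0 = P \<and> (\<forall>\<^sub>F s in nhds 0. \<gamma> s \<in> E) \<and>
     (\<gamma> has_vector_derivative w) (at 0))"

definition normal_line :: "(real^2) set \<Rightarrow> real^2 \<Rightarrow> (real^2) set" where
  "normal_line E P = {X. \<forall>w. tangent_vector E P w \<longrightarrow> (X - P) \<bullet> w = 0}"

text \<open>The unsigned angle, in \<open>[0, \<pi>]\<close>, at \<open>P\<close> between the rays towards \<open>A\<close> and \<open>B\<close>.\<close>

definition angle_at :: "real^2 \<Rightarrow> real^2 \<Rightarrow> real^2 \<Rightarrow> real" where
  "angle_at P A B = arccos (((A - P) \<bullet> (B - P)) / (norm (A - P) * norm (B - P)))"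

text \<open>Requiring half of the angle itself, rather than only equal angles with both sides, makes
  the ray from \<open>P\<close> through \<open>X\<close> the internal bisector.\<close>

definition bisects_angle :: "(real^2) set \<Rightarrow> real^2 \<Rightarrow> real^2 \<Rightarrow> real^2 \<Rightarrow> bool" where
  "bisects_angle L P A B \<longleftrightarrow> P \<in> L \<and>
     (\<exists>X\<in>L. X \<noteq> P \<and> angle_at P A X = angle_at P A B / 2 \<and> angle_at P X B = angle_at P A B / 2)"

definition three_periodics :: "(real^2) set \<Rightarrow> (real^2) set set" where
  "three_periodics E = {T. is_triangle T \<and> T \<subseteq> E \<and>
     (\<forall>P A B. T = {P, A, B} \<longrightarrow> bisects_angle (normal_line E P) P A B)}"

text \<open>These are the orientation-preserving similarities: every composition of rotations,
  translations and uniform dilations can be put in this form.\<close>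

definition is_similarity :: "(real^2 \<Rightarrow> real^2) \<Rightarrow> bool" where
  "is_similarity f \<longleftrightarrow> (\<exists>k A b. k > 0 \<and> rotation_matrix A \<and> f = (\<lambda>x. k *\<^sub>R (A *v x) + b))"

end

theory Submission
  imports Defs
begin

text \<open>Identify the plane with the complex numbers and scale the circumcircle to the unit circle, so
  that the incentre is a real \<open>d \<in> [0,1)\<close> and the inradius is \<open>(1 - d\<^sup>2)/2\<close>. The bisector at a vertex
  \<open>z\<close> meets the circle again at an arc midpoint, and this gives
  \<open>z ((z - d)/(1 - d z))\<^sup>2 = \<lambda>\<close> where \<open>\<lambda>\<close> is the product of the vertices. So the poristic triangles are
  the fibres of a Blaschke product of degree three.

  Writing \<open>\<lambda>\<close> as a function of one vertex, one checks that each vertex of the fibre over \<open>\<lambda>\<close> lies on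
  an explicit ellipse whose normal there passes through \<open>d\<close>: the triangle is a 3-periodic of that
  ellipse. The axis ratio of the ellipse depends on \<open>d\<close> only, so a similarity (for \<open>d > 0\<close> unique up to sign)
  carries it to a fixed ellipse.

  Conversely, the gradients of an ellipse at the vertices of a 3-periodic are determined up to a
  common factor by the triangle, since a chord is orthogonal to the sum of the gradients at its
  ends. Hence the ellipse is the explicit one, and the axis ratio forces the same \<open>d\<close>. The two signs
  of the similarity are separated by the parity of the number of turns made by \<open>t\<close>, because
  \<open>t\<close> and \<open>t + 2\<pi>\<close> give the same poristic triangle.\<close>

subsection \<open>The circumellipse of a poristic triangle\<close>

text \<open>Every symmetric real-linear map of the plane sends w to a w + m cnj w with a real. Its
  eigenvalues are a + |m| and a - |m|, and a rotation of the coordinates changes only the argument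
  of m. Hence a factor \<open>l\<close> of modulus one turns the axes of an ellipse without changing
  their ratio, and the equation \<open>cnj m = l * m\<close> says that multiplication by
  \<open>m\<close> brings the ellipse into standard position. For given size this leaves exactly two
  choices of \<open>m\<close>, which differ by a sign.

  The obstacle on the geometric side is that an internal bisector involves the lengths of the sides,
  which are not algebraic in the vertices. Squaring the bisector direction removes them up to a real
  factor, and on the unit circle, where conjugation is inversion, comparison with the conjugate
  relation removes that factor.

  For \<open>d = 0\<close> the ellipse is a circle and its gradients say nothing about the rotation,
  which has to be fixed by a separate choice. The similarities need not depend continuously on t, so
  any branch of the square root of the level serves.\<close>

definition poncelet_root :: "real \<Rightarrow> complex \<Rightarrow> complex \<Rightarrow> bool" where
  "poncelet_root d l z \<longleftrightarrow> cmod z = 1 \<and> z * (z - d)\<^sup>2 = l * (1 - d * z)\<^sup>2"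

text \<open>The gradient map, centre and level of the ellipse attached to \<open>l\<close>; its centre is the
  Mittenpunkt of the triangle. The formulas were found by interpolating between the two isosceles
  triangles of the family.\<close>

definition conic_map :: "real \<Rightarrow> complex \<Rightarrow> complex \<Rightarrow> complex" where
  "conic_map d l w = (3 - d\<^sup>2) * w + 2 * d * l * cnj w"

definition conic_centre :: "real \<Rightarrow> complex \<Rightarrow> complex" where
  "conic_centre d l = d * (3 + d\<^sup>2 + 4 * d * l) / (9 - d\<^sup>2)"

definition conic_level :: "real \<Rightarrow> complex \<Rightarrow> real" where
  "conic_level d l = (1 - d\<^sup>2) * (27 - 18 * d\<^sup>2 - d^4 - 8 * d^3 * Re l) / (9 - d\<^sup>2)"

text \<open>On the unit circle the denominator is |z - d|^2. The value is the ratio of the gradient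
  at the vertex \<open>z\<close> to \<open>z - d\<close>: although the gradient is built from
  \<open>l\<close>, this ratio is a function of the vertex alone.\<close>

definition normal_factor :: "real \<Rightarrow> complex \<Rightarrow> real" where
  "normal_factor d z = (1 - d\<^sup>2) * (3 - d\<^sup>2 - 2 * d * Re z) / (1 + d\<^sup>2 - 2 * d * Re z)"

lemma unit_mult_cnj: "cmod z = 1 \<Longrightarrow> z * cnj z = 1"
  by (simp add: complex_norm_square[symmetric])

lemma pole_and_centre_ne_0:
  fixes z :: complex
  assumes "cmod z = 1" "0 \<le> d" "d < 1"
  shows "1 - complex_of_real d * z \<noteq> 0" "z - complex_of_real d \<noteq> 0"
proof -
  show "1 - complex_of_real d * z \<noteq> 0"
  proof
    assume "1 - complex_of_real d * z = 0"
    then have "cmod (complex_of_real d * z) = 1" by simp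
    then show False using assms by (simp add: norm_mult)
  qed
  show "z - complex_of_real d \<noteq> 0"
  proof
    assume "z - complex_of_real d = 0"
    then have "cmod z = d" using assms by simp
    then show False using assms by simp
  qed
qed

lemma normal_denominator:
  fixes z :: complex
  assumes "cmod z = 1" "0 \<le> d" "d < 1"
  shows "1 + d\<^sup>2 - 2 * d * Re z > 0" "3 - d\<^sup>2 - 2 * d * Re z > 0"
    "complex_of_real (1 + d\<^sup>2 - 2 * d * Re z) = (z - d) * (cnj z - d)"
proof -
  have "Re z \<le> 1" using assms(1) complex_Re_le_cmod by metis
  then have le: "d * Re z \<le> d" using assms(2) by (simp add: mult_left_le)
  have "(1 - d)\<^sup>2 > 0" using assms by simp
  then have "1 + d\<^sup>2 - 2 * d > 0" by (simp add: power2_eq_square algebra_simps)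
  then show "1 + d\<^sup>2 - 2 * d * Re z > 0" using le by linarith
  have "d\<^sup>2 < 1" using assms by (simp add: power_less_one_iff)
  then show "3 - d\<^sup>2 - 2 * d * Re z > 0" using le assms by linarith
  have "(z - d) * (cnj z - d) = z * cnj z + d^2 - d * (z + cnj z)"
    by (simp add: algebra_simps power2_eq_square)
  then show "complex_of_real (1 + d\<^sup>2 - 2 * d * Re z) = (z - d) * (cnj z - d)"
    using unit_mult_cnj[OF assms(1)] by (simp add: complex_add_cnj)
qed

text \<open>The root equation, read as \<open>l * (cnj z - d) * (1 - d * z) = (z - d)^2\<close>,
  removes \<open>l\<close> after multiplication by the nonzero \<open>1 - d * z\<close>. What
  remains is an identity in \<open>z\<close> and \<open>cnj z\<close> modulo
  \<open>z * cnj z = 1\<close>. Geometrically, the normal of the ellipse at each vertex passes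
  through the incentre.\<close>

lemma conic_map_vertex:
  fixes z l :: complex
  assumes z: "poncelet_root d l z" and d: "0 \<le> d" "d < 1"
  shows "conic_map d l (z - conic_centre d l) = normal_factor d z * (z - d)"
    and "cmod l = 1"
proof -
  have c1: "cmod z = 1" and eq: "z * (z - d)\<^sup>2 = l * (1 - d * z)\<^sup>2"
    using z by (auto simp: poncelet_root_def)
  note ne = pole_and_centre_ne_0[OF c1 d]
  have zz: "z * cnj z = 1" using unit_mult_cnj[OF c1] .
  have flip: "1 - d * z = z * (cnj z - d)" using zz by (simp add: algebra_simps)
  have "cmod (1 - d * z) = cmod (z - d)"
    unfolding flip norm_mult c1 using complex_mod_cnj[of "z - d"] by simp
  moreover have "cmod (z * (z - d)\<^sup>2) = cmod (l * (1 - d * z)\<^sup>2)" using eq by simp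
  ultimately show l: "cmod l = 1" using ne c1 by (simp add: norm_mult norm_power)
  have ll: "l * cnj l = 1" using unit_mult_cnj[OF l] .
  have d9: "(9 - complex_of_real d ^ 2) \<noteq> 0"
  proof -
    have "d^2 < 1" using d by (simp add: power_less_one_iff)
    then have "9 - d^2 \<noteq> 0" by simp
    then show ?thesis using of_real_eq_0_iff[of "9 - d^2", where 'a=complex] by simp
  qed
  \<comment> \<open>The centre c solves conic_map d l c = d + d^3 + 2 d^2 l. The determinant of the
    map is (3 - d^2)^2 - 4 d^2 = (9 - d^2)(1 - d^2); the factor 1 - d^2 cancels, which leaves the
    denominator 9 - d^2.\<close>
  have "conic_map d l (z - conic_centre d l) * (9 - complex_of_real d ^ 2) =
     ((3 - d^2) * z - d - d^3 + 2 * d * l * (cnj z - d)) * (9 - complex_of_real d ^ 2)"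
  proof -
    have c: "conic_centre d l * (9 - complex_of_real d ^ 2) = d * (3 + d\<^sup>2 + 4 * d * l)"
      using d9 by (simp add: conic_centre_def)
    have c': "cnj (conic_centre d l) * (9 - complex_of_real d ^ 2) = d * (3 + d\<^sup>2 + 4 * d * cnj l)"
      using d9 by (simp add: conic_centre_def)
    have "conic_map d l (z - conic_centre d l) * (9 - complex_of_real d ^ 2) =
      (3 - d\<^sup>2) * (z * (9 - complex_of_real d ^ 2) - conic_centre d l * (9 - complex_of_real d ^ 2))
      + 2 * d * l * (cnj z * (9 - complex_of_real d ^ 2) - cnj (conic_centre d l) * (9 - complex_of_real d ^ 2))"
      unfolding conic_map_def by (simp add: algebra_simps)
    also have "\<dots> = ((3 - d^2) * z - d - d^3 + 2 * d * l * (cnj z - d)) * (9 - complex_of_real d ^ 2)"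
      unfolding c c' using ll by simp algebra
    finally show ?thesis .
  qed
  then have e1: "conic_map d l (z - conic_centre d l) = (3 - d^2) * z - d - d^3 + 2 * d * l * (cnj z - d)"
    using d9 by simp
  have lz: "l * (cnj z - d) * (1 - d * z) = (z - d)^2"
    using eq zz flip by algebra
  have h: "complex_of_real (1 + d\<^sup>2 - 2 * d * Re z) = (z - d) * (cnj z - d)"
    and hpos: "1 + d\<^sup>2 - 2 * d * Re z > 0" using normal_denominator[OF c1 d] by auto
  have "complex_of_real (normal_factor d z) * complex_of_real (1 + d\<^sup>2 - 2 * d * Re z) =
     complex_of_real ((1 - d\<^sup>2) * (3 - d\<^sup>2 - 2 * d * Re z))"
    unfolding of_real_mult[symmetric] normal_factor_def using hpos by simp
  also have "\<dots> = (1 - d^2) * (3 - d^2 - d * (z + cnj z))"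
    by (simp add: complex_add_cnj)
  finally have nf: "normal_factor d z * ((z - d) * (cnj z - d)) = (1 - d^2) * (3 - d^2 - d * (z + cnj z))"
    unfolding h .
  define D k where "D = complex_of_real d" and "k = complex_of_real (normal_factor d z)"
  have "k * (z - D) * (1 - D * z) = z * (k * ((z - D) * (cnj z - D)))"
    unfolding flip[folded D_def] by algebra
  also have "\<dots> = (1 - D^2) * ((3 - D^2) * z - D * z^2 - D * (z * cnj z))"
    unfolding nf[folded D_def k_def] by (simp add: algebra_simps D_def power2_eq_square)
  also have "\<dots> = ((3 - D^2) * z - D - D^3) * (1 - D * z) + 2 * D * (z - D)^2"
    unfolding zz by algebra
  also have "\<dots> = ((3 - D^2) * z - D - D^3 + 2 * D * l * (cnj z - D)) * (1 - D * z)"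
    unfolding lz[folded D_def, symmetric] by algebra
  finally have "((3 - d^2) * z - d - d^3 + 2 * d * l * (cnj z - d)) * (1 - d * z) = normal_factor d z * (z - d) * (1 - d * z)"
    by (auto simp: D_def k_def)
  then show "conic_map d l (z - conic_centre d l) = normal_factor d z * (z - d)"
    using e1 ne by simp
qed

lemma normal_factor_pos:
  assumes "cmod z = 1" "0 \<le> d" "d < 1"
  shows "normal_factor d z > 0"
proof -
  have "d\<^sup>2 < 1" using assms by (simp add: power_less_one_iff)
  then show ?thesis using normal_denominator[OF assms] by (simp add: normal_factor_def)
qed

lemma nine_minus_square_ne_0:
  assumes "0 \<le> d" "d < 1"
  shows "9 - complex_of_real d ^ 2 \<noteq> 0" "9 - d^2 > 0"
proof -
  have "d^2 < 1" using assms by (simp add: power_less_one_iff)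
  then show "9 - d^2 > 0" by simp
  then have "9 - d^2 \<noteq> 0" by simp
  then show "9 - complex_of_real d ^ 2 \<noteq> 0"
    using of_real_eq_0_iff[of "9 - d^2", where 'a=complex] by simp
qed

text \<open>Once the gradient is known to be a multiple of \<open>z - d\<close>, the value times |z
  - d|^4 is symmetric in \<open>z\<close> and \<open>cnj z\<close>, hence a polynomial in
  \<open>s = z + zb\<close>. The root equation turns \<open>l * h^2\<close> into
  \<open>zb * (z - D)^4\<close>, so the contribution of \<open>Re l\<close> becomes a polynomial in
  \<open>s\<close> too, and the dependence on the vertex cancels.\<close>

lemma conic_level_vertex:
  fixes z l :: complex
  assumes z: "poncelet_root d l z" and d: "0 \<le> d" "d < 1"
  shows "Re (cnj (z - conic_centre d l) * conic_map d l (z - conic_centre d l)) = conic_level d l"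
proof -
  have c1: "cmod z = 1" and eq: "z * (z - d)\<^sup>2 = l * (1 - d * z)\<^sup>2"
    using z by (auto simp: poncelet_root_def)
  note ne = pole_and_centre_ne_0[OF c1 d]
  define zb where "zb = cnj z"
  define c where "c = conic_centre d l"
  define D where "D = complex_of_real d"
  define k where "k = complex_of_real (normal_factor d z)"
  define h where "h = (z - D) * (zb - D)"
  have zz: "z * zb = 1" using unit_mult_cnj[OF c1] by (simp add: zb_def)
  have ll: "l * cnj l = 1" using unit_mult_cnj conic_map_vertex(2)[OF z d] by blast
  have flip: "1 - D * z = z * (zb - D)" "1 - D * zb = zb * (z - D)" using zz by (simp_all add: algebra_simps)
  have hne: "h \<noteq> 0"
    using ne unfolding h_def zb_def D_def by (metis complex_cnj_cnj complex_cnj_complex_of_real complex_cnj_diff mult_eq_0_iff right_minus_eq)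
  have nf: "k * h = (1 - D^2) * (3 - D^2 - D * (z + zb))"
  proof -
    have h': "complex_of_real (1 + d\<^sup>2 - 2 * d * Re z) = h"
      and hpos: "1 + d\<^sup>2 - 2 * d * Re z > 0" using normal_denominator[OF c1 d]
      by (auto simp: h_def zb_def D_def)
    have "complex_of_real (normal_factor d z) * complex_of_real (1 + d\<^sup>2 - 2 * d * Re z) =
     complex_of_real ((1 - d\<^sup>2) * (3 - d\<^sup>2 - 2 * d * Re z))"
      unfolding of_real_mult[symmetric] normal_factor_def using hpos by simp
    also have "\<dots> = (1 - D^2) * (3 - D^2 - D * (z + zb))"
      by (simp add: complex_add_cnj zb_def D_def)
    finally show ?thesis unfolding h' k_def .
  qed
  have d9: "9 - D^2 \<noteq> 0" using nine_minus_square_ne_0[OF d] by (simp add: D_def)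
  have c: "c * (9 - D ^ 2) = D * (3 + D\<^sup>2 + 4 * D * l)"
    using d9 by (simp add: c_def conic_centre_def D_def)
  have c': "cnj c * (9 - D ^ 2) = D * (3 + D\<^sup>2 + 4 * D * cnj l)"
    using d9 by (simp add: c_def conic_centre_def D_def)
  have eqD: "z * (z - D)\<^sup>2 = l * (1 - D * z)\<^sup>2" using eq by (simp add: D_def)
  have eqD': "zb * (zb - D)\<^sup>2 = cnj l * (1 - D * zb)\<^sup>2"
    using arg_cong[OF eq, of cnj] by (simp add: D_def zb_def)
  have lz: "l * h^2 = zb * (z - D)^4"
  proof -
    have "l * (z * (zb - D))\<^sup>2 * zb^2 = l * (zb - D)^2" using zz by algebra
    then show ?thesis using eqD zz unfolding flip h_def by algebra
  qed
  have lz': "cnj l * h^2 = z * (zb - D)^4"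
  proof -
    have "cnj l * (zb * (z - D))\<^sup>2 * z^2 = cnj l * (z - D)^2" using zz by algebra
    then show ?thesis using eqD' zz unfolding flip h_def by algebra
  qed
  \<comment> \<open>The centre brings in \<open>l\<close> and \<open>cnj l\<close> with a single
    factor \<open>h\<close>; these versions come from the previous two by cancelling one linear
    factor.\<close>
  have a1: "l * h * (zb - D) = zb * (z - D)^3"
  proof -
    have "(l * h * (zb - D)) * (z - D) = (zb * (z - D)^3) * (z - D)" using lz unfolding h_def by algebra
    then show ?thesis using ne by (simp add: D_def)
  qed
  have a2: "cnj l * h * (z - D) = z * (zb - D)^3"
  proof -
    have "(cnj l * h * (z - D)) * (zb - D) = (z * (zb - D)^3) * (zb - D)" using lz' unfolding h_def by algebra
    then show ?thesis using hne by (simp add: h_def)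
  qed
  define s where "s = z + zb"
  have h_s: "h = 1 + D^2 - D * s"
    using zz unfolding h_def s_def by algebra
  have q4: "zb * (z - D)^4 + z * (zb - D)^4 = s^3 - 3 * s - 4 * D * (s^2 - 2) + 6 * D^2 * s - 8 * D^3 + D^4 * s"
    using zz unfolding s_def by algebra
  have q3: "z * (zb - D)^3 + zb * (z - D)^3 = s^2 - 2 - 3 * D * s + 6 * D^2 - D^3 * s"
    using zz unfolding s_def by algebra
  have "cnj (z - c) * (k * (z - D)) + (z - c) * (k * (zb - D))
      = k * (2 - D * s - cnj c * (z - D) - c * (zb - D))"
    using zz unfolding zb_def[symmetric] complex_cnj_diff s_def by algebra
  then have "(cnj (z - c) * (k * (z - D)) + (z - c) * (k * (zb - D))) * (9 - D^2) * h^2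
      = (k * h) * ((2 - D * s) * (9 - D^2) * h - (cnj c * (9 - D ^ 2)) * (z - D) * h - (c * (9 - D ^ 2)) * (zb - D) * h)"
    by algebra
  also have "\<dots> = (k * h) * ((2 - D * s) * (9 - D^2) * h - (D * (3 + D\<^sup>2)) * (s - 2 * D) * h
        - 4 * D^2 * (z * (zb - D)^3 + zb * (z - D)^3))"
    unfolding c c' a1[symmetric] a2[symmetric] s_def by algebra
  also have "\<dots> = (1 - D^2) * (2 * (27 - 18 * D^2 - D^4) * h^2 - 8 * D^3 * (zb * (z - D)^4 + z * (zb - D)^4))"
    unfolding nf[folded s_def] q3 q4 unfolding h_s by algebra
  also have "\<dots> = (1 - D^2) * (2 * (27 - 18 * D^2 - D^4) - 8 * D^3 * (l + cnj l)) * h^2"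
    unfolding lz[symmetric] lz'[symmetric] by algebra
  finally have main: "(cnj (z - c) * (k * (z - D)) + (z - c) * (k * (zb - D))) * (9 - D^2)
       = (1 - D^2) * (2 * (27 - 18 * D^2 - D^4) - 8 * D^3 * (l + cnj l))"
    using hne by simp
  have "(z - c) * (k * (zb - D)) = cnj (cnj (z - c) * (k * (z - D)))"
    by (simp add: zb_def D_def k_def)
  then have two: "complex_of_real (2 * Re (cnj (z - c) * (k * (z - D)))) = cnj (z - c) * (k * (z - D)) + (z - c) * (k * (zb - D))"
    using complex_add_cnj by metis
  have "complex_of_real (2 * Re (cnj (z - c) * (k * (z - D))) * (9 - d^2))
     = complex_of_real (2 * Re (cnj (z - c) * (k * (z - D)))) * (9 - D^2)"
    by (simp add: D_def)
  also have "\<dots> = complex_of_real (2 * ((1 - d^2) * (27 - 18 * d^2 - d^4 - 8 * d^3 * Re l)))"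
    unfolding two main by (simp add: D_def complex_add_cnj algebra_simps)
  finally have "2 * Re (cnj (z - c) * (k * (z - D))) * (9 - d^2) = 2 * ((1 - d^2) * (27 - 18 * d^2 - d^4 - 8 * d^3 * Re l))"
    using of_real_eq_iff by blast
  then have "Re (cnj (z - c) * (k * (z - D))) = conic_level d l"
    using nine_minus_square_ne_0[OF d] unfolding conic_level_def by (simp add: field_simps)
  then show ?thesis
    using conic_map_vertex(1)[OF z d] by (simp add: c_def k_def D_def)
qed

text \<open>The worst case on the unit circle is \<open>l = 1\<close>, where the second factor of
  the numerator is \<open>(1 - d) * (3 + d)^3\<close>. Positivity allows the ellipse to be rescaled
  to level one.\<close>

lemma conic_level_pos:
  assumes "cmod l = 1" "0 \<le> d" "d < 1"
  shows "conic_level d l > 0"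
proof -
  have "Re l \<le> 1" using assms(1) complex_Re_le_cmod by metis
  then have "d^3 * Re l \<le> d^3" using assms by (simp add: mult_left_le)
  moreover have "27 - 18 * d^2 - d^4 - 8 * d^3 = (1 - d) * (3 + d)^3" by algebra
  moreover have "(1 - d) * (3 + d)^3 > 0" using assms by simp
  moreover have "d\<^sup>2 < 1" using assms by (simp add: power_less_one_iff)
  ultimately have "27 - 18 * d^2 - d^4 - 8 * d^3 * Re l > 0" "1 - d^2 > 0" by auto
  then show ?thesis using nine_minus_square_ne_0[of d] assms by (simp add: conic_level_def)
qed

subsection \<open>Bisectors and uniqueness of the circumellipse\<close>

text \<open>Direction of the internal bisector at \<open>A\<close>: it is the diagonal of the rhombus spanned by
  the rescaled sides.\<close>

definition bisector_point :: "complex \<Rightarrow> complex \<Rightarrow> complex \<Rightarrow> complex \<Rightarrow> bool" where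
  "bisector_point A B C X \<longleftrightarrow> (\<exists>k>0. X - A = k *\<^sub>R (cmod (C - A) *\<^sub>R (B - A) + cmod (B - A) *\<^sub>R (C - A)))"

text \<open>The argument of the bisector is half the sum of the arguments of the two sides, so its
  square is a real multiple of their product. Only the reality of the factor is recorded, which is
  all that the cubic equation of the vertices requires.\<close>

lemma bisector_square:
  assumes "bisector_point A B C X"
  shows "\<exists>k::real. (X - A)\<^sup>2 = k * ((B - A) * (C - A))"
proof -
  obtain k where "X - A = k *\<^sub>R (cmod (C - A) *\<^sub>R (B - A) + cmod (B - A) *\<^sub>R (C - A))"
    using assms unfolding bisector_point_def by blast
  then have g: "X - A = complex_of_real k * (cmod (C - A) * (B - A) + cmod (B - A) * (C - A))"
    by (simp add: scaleR_conv_of_real)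
  define e f where "e = B - A" and "f = C - A"
  define m n where "m = complex_of_real (cmod e)" and "n = complex_of_real (cmod f)"
  have m: "m^2 = e * cnj e" and n: "n^2 = f * cnj f"
    by (simp_all only: m_def n_def complex_norm_square of_real_power[symmetric])
  have "(X - A)\<^sup>2 = complex_of_real k ^ 2 * (f * cnj f * e^2 + 2 * m * n * e * f + e * cnj e * f^2)"
    using m n unfolding g e_def[symmetric] f_def[symmetric] m_def[symmetric] n_def[symmetric] by algebra
  also have "\<dots> = complex_of_real k ^ 2 * (2 * m * n + (e * cnj f + cnj (e * cnj f))) * (e * f)"
    by (simp add: algebra_simps power2_eq_square)
  also have "\<dots> = complex_of_real (k^2 * (2 * cmod e * cmod f + 2 * Re (e * cnj f))) * (e * f)"
    unfolding complex_add_cnj by (simp add: m_def n_def)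
  finally show ?thesis unfolding e_def f_def by blast
qed

text \<open>The squared bisector relation and its conjugate share the real factor \<open>k\<close>.
  On the unit circle \<open>z2 - z1 = - z1 * z2 * (y2 - y1)\<close>, and likewise for
  \<open>z3\<close>, so the right-hand sides of the two relations differ by the factor
  \<open>z1^2 * z2 * z3\<close>, and \<open>k\<close> drops out.\<close>

lemma bisector_imp_poncelet_root:
  fixes d :: real
  assumes c: "cmod z1 = 1" "cmod z2 = 1" "cmod z3 = 1" and ne: "z1 \<noteq> z2" "z1 \<noteq> z3"
    and b: "bisector_point z1 z2 z3 (complex_of_real d)"
  shows "poncelet_root d (z1 * z2 * z3) z1"
proof -
  define D where "D = complex_of_real d"
  define y1 y2 y3 where "y1 = cnj z1" and "y2 = cnj z2" and "y3 = cnj z3"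
  have zy: "z1 * y1 = 1" "z2 * y2 = 1" "z3 * y3 = 1"
    using c unit_mult_cnj by (auto simp: y1_def y2_def y3_def)
  obtain k :: real where k: "(D - z1)\<^sup>2 = k * ((z2 - z1) * (z3 - z1))"
    using bisector_square[OF b] by (auto simp: D_def)
  have k': "(D - y1)\<^sup>2 = k * ((y2 - y1) * (y3 - y1))"
    using arg_cong[OF k, of cnj] by (simp add: D_def y1_def y2_def y3_def)
  have e: "(z2 - z1) = - z1 * z2 * (y2 - y1)" "(z3 - z1) = - z1 * z3 * (y3 - y1)"
    using zy by algebra+
  have "(D - z1)\<^sup>2 = z1^2 * z2 * z3 * (D - y1)^2"
    unfolding k k' e by algebra
  then have "z1 * (z1 - D)^2 = z1 * z2 * z3 * (1 - D * z1)^2"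
    using zy by algebra
  then show ?thesis using c by (simp add: poncelet_root_def D_def)
qed

lemma cubic_roots_vieta:
  fixes a b :: complex
  assumes "z1^3 - a * z1^2 + b * z1 = l" "z2^3 - a * z2^2 + b * z2 = l" "z3^3 - a * z3^2 + b * z3 = l"
    and "z1 \<noteq> z2" "z1 \<noteq> z3" "z2 \<noteq> z3"
  shows "a = z1 + z2 + z3" "b = z1 * z2 + z2 * z3 + z1 * z3" "l = z1 * z2 * z3"
proof -
  have "(z1 - z2) * (z1^2 + z1*z2 + z2^2 - a * (z1 + z2) + b) = (z1^3 - a * z1^2 + b * z1) - (z2^3 - a * z2^2 + b * z2)"
    by algebra
  also have "\<dots> = 0" using assms(1,2) by simp
  finally have "(z1 - z2) * (z1^2 + z1*z2 + z2^2 - a * (z1 + z2) + b) = 0" .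
  then have 1: "z1^2 + z1*z2 + z2^2 - a * (z1 + z2) + b = 0" using assms by simp
  have "(z1 - z3) * (z1^2 + z1*z3 + z3^2 - a * (z1 + z3) + b) = (z1^3 - a * z1^2 + b * z1) - (z3^3 - a * z3^2 + b * z3)"
    by algebra
  also have "\<dots> = 0" using assms(1,3) by simp
  finally have "(z1 - z3) * (z1^2 + z1*z3 + z3^2 - a * (z1 + z3) + b) = 0" .
  then have 2: "z1^2 + z1*z3 + z3^2 - a * (z1 + z3) + b = 0" using assms by simp
  have "(z2 - z3) * (z1 + z2 + z3 - a) = 0" using 1 2 by algebra
  then show a: "a = z1 + z2 + z3" using assms by simp
  show b: "b = z1 * z2 + z2 * z3 + z1 * z3" using 1 a by algebra
  have "z1^3 - a * z1^2 + b * z1 = z1 * z2 * z3" unfolding a b by algebra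
  then show "l = z1 * z2 * z3" using assms(1) by simp
qed

text \<open>Expanded, the root equation is
  \<open>z^3 - (2*d + l*d^2) * z^2 + (d^2 + 2*d*l) * z = l\<close>. The sum is kept because it
  recovers a third vertex from two vertices and the level.\<close>

lemma poncelet_root_vieta:
  assumes "poncelet_root d l z1" "poncelet_root d l z2" "poncelet_root d l z3"
    and "z1 \<noteq> z2" "z1 \<noteq> z3" "z2 \<noteq> z3"
  shows "l = z1 * z2 * z3" "z1 + z2 + z3 = 2 * d + l * d\<^sup>2"
proof -
  have "z^3 - (2 * d + l * d\<^sup>2) * z^2 + (d\<^sup>2 + 2 * d * l) * z = l" if "poncelet_root d l z" for z
  proof -
    have "z * (z - d)\<^sup>2 = l * (1 - d * z)\<^sup>2" using that by (simp add: poncelet_root_def)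
    then show ?thesis
      unfolding of_real_add of_real_mult of_real_power of_real_numeral by algebra
  qed
  from cubic_roots_vieta[OF this[OF assms(1)] this[OF assms(2)] this[OF assms(3)] assms(4-6)]
  show "l = z1 * z2 * z3" "z1 + z2 + z3 = 2 * d + l * d\<^sup>2" by auto
qed

section \<open>Uniqueness of an ellipse with prescribed normals at three points\<close>

lemma real_linear_zero:
  fixes a :: real and b v w :: complex
  assumes "Im (cnj v * w) \<noteq> 0" "a * v + b * cnj v = 0" "a * w + b * cnj w = 0"
  shows "a = 0" "b = 0"
proof -
  have "complex_of_real a * (cnj v * w - cnj (cnj v * w)) = 0"
    using assms(2,3) unfolding complex_cnj_mult complex_cnj_cnj by algebra
  then have "complex_of_real a * (complex_of_real (2 * Im (cnj v * w)) * \<i>) = 0"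
    unfolding complex_diff_cnj by simp
  then have "a = 0 \<or> 2 * Im (cnj v * w) = 0"
    by (metis mult_eq_0_iff of_real_eq_0_iff complex_i_not_zero)
  then show a: "a = 0" using assms(1) by simp
  have "v \<noteq> 0" using assms(1) by auto
  then show "b = 0" using assms(2) a by simp
qed

text \<open>The mixed terms cancel because the map is self-adjoint for real \<open>a\<close>. At
  equal levels the right side vanishes, and this is the orthogonality of a chord to the sum of the
  gradients at its ends.\<close>

lemma symmetric_map_inner:
  fixes a :: real and m u v :: complex
  shows "Re (cnj (u - v) * (a * u + m * cnj u)) + Re (cnj (u - v) * (a * v + m * cnj v))
    = Re (cnj u * (a * u + m * cnj u)) - Re (cnj v * (a * v + m * cnj v))"
  by (simp add: algebra_simps)

lemma abs_Re_less_cmod: "Im z \<noteq> 0 \<Longrightarrow> \<bar>Re z\<bar> < cmod z"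
  using abs_Re_le_cmod[of z] complex_eq_iff cmod_power2[of z]
  by (metis abs_less_iff less_eq_real_def norm_ge_zero power2_abs add_cancel_right_right power2_eq_iff_nonneg zero_eq_power2)

text \<open>A side and the internal bisector enclose half of an angle strictly between 0 and pi,
  hence an acute angle. The strict sign permits the division in \<open>gradient_ratio\<close> and
  shows that \<open>X\<close> differs from the vertex.\<close>

lemma bisector_inner_pos:
  assumes b: "bisector_point A B C X" and ne: "Im (cnj (B - A) * (C - A)) \<noteq> 0"
  shows "Re (cnj (A - B) * (A - X)) > 0" "Re (cnj (A - C) * (A - X)) > 0"
proof -
  obtain k where k: "k > 0" and g: "X - A = k *\<^sub>R (cmod (C - A) *\<^sub>R (B - A) + cmod (B - A) *\<^sub>R (C - A))"
    using b unfolding bisector_point_def by blast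
  define e f where "e = B - A" and "f = C - A"
  have "\<bar>Re (cnj e * f)\<bar> < cmod e * cmod f"
    using abs_Re_less_cmod[OF ne] by (simp only: e_def f_def norm_mult complex_mod_cnj)
  then have p: "cmod e * cmod f + Re (cnj e * f) > 0" by linarith
  have nz: "cmod e > 0" "cmod f > 0" using ne unfolding e_def f_def by auto
  have g': "A - X = - (k *\<^sub>R (cmod f *\<^sub>R e + cmod e *\<^sub>R f))" using g by (simp add: e_def f_def algebra_simps)
  have 1: "Re (cnj (- e) * (A - X)) = k * cmod e * (cmod e * cmod f + Re (cnj e * f))"
    unfolding g' using cmod_power2[of e] by (simp add: algebra_simps power2_eq_square; algebra)
  have 2: "Re (cnj (- f) * (A - X)) = k * cmod f * (cmod e * cmod f + Re (cnj e * f))"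
    unfolding g' using cmod_power2[of f] by (simp add: algebra_simps power2_eq_square; algebra)
  show "Re (cnj (A - B) * (A - X)) > 0" using 1 p nz k by (simp add: e_def)
  show "Re (cnj (A - C) * (A - X)) > 0" using 2 p nz k by (simp add: f_def)
qed

text \<open>Two conics through \<open>z\<close> and \<open>w\<close> whose normals there pass through a common point have
  proportional gradients: a chord \<open>z w\<close> is orthogonal to the sum of the gradients at its ends.\<close>

lemma gradient_ratio:
  fixes a a' k k' j j' :: real and m m' c c' z w X :: complex
  assumes z: "a * (z - c) + m * cnj (z - c) = k * (z - X)" "a' * (z - c') + m' * cnj (z - c') = k' * (z - X)"
    and w: "a * (w - c) + m * cnj (w - c) = j * (w - X)" "a' * (w - c') + m' * cnj (w - c') = j' * (w - X)"
    and q: "Re (cnj (z - c) * (k * (z - X))) = Re (cnj (w - c) * (j * (w - X)))"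
      "Re (cnj (z - c') * (k' * (z - X))) = Re (cnj (w - c') * (j' * (w - X)))"
    and pos: "Re (cnj (w - z) * (w - X)) > 0" and k': "k' \<noteq> 0"
  shows "j = k / k' * j'"
proof -
  \<comment> \<open>At equal levels the chord relation fixes the ratio of \<open>r\<close> to
    \<open>t\<close> by \<open>z\<close>, \<open>w\<close> and \<open>X\<close> alone, whichever the
    conic.\<close>
  have r: "r * Re (cnj (w - z) * (w - X)) = t * Re (cnj (z - w) * (z - X))"
    if "a * (z - c) + m * cnj (z - c) = t * (z - X)" "a * (w - c) + m * cnj (w - c) = r * (w - X)"
      "Re (cnj (z - c) * (t * (z - X))) = Re (cnj (w - c) * (r * (w - X)))"
    for a r t :: real and m c :: complex
  proof -
    have "Re (cnj ((z - c) - (w - c)) * (t * (z - X))) + Re (cnj ((z - c) - (w - c)) * (r * (w - X))) = 0"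
      unfolding that(1,2)[symmetric] symmetric_map_inner unfolding that(1,2) that(3) by simp
    then show ?thesis by (simp add: algebra_simps)
  qed
  have 1: "j * Re (cnj (w - z) * (w - X)) = k * Re (cnj (z - w) * (z - X))"
    using r[OF z(1) w(1) q(1)] .
  have 2: "j' * Re (cnj (w - z) * (w - X)) = k' * Re (cnj (z - w) * (z - X))"
    using r[OF z(2) w(2) q(2)] .
  have "(j * k') * Re (cnj (w - z) * (w - X)) = (k * j') * Re (cnj (w - z) * (w - X))"
    using 1 2 by algebra
  then have "j * k' = k * j'" using pos by simp
  then show ?thesis using k' by (simp add: field_simps)
qed

text \<open>The smaller eigenvalue \<open>3 - d^2 - 2*d = (3 + d) * (1 - d)\<close> is positive;
  comparing the moduli of the two summands expresses this.\<close>

lemma conic_map_inj: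
  assumes "conic_map d l v = conic_map d l w" "cmod l = 1" "0 \<le> d" "d < 1"
  shows "v = w"
proof -
  have "conic_map d l (v - w) = 0" using assms(1) by (simp add: conic_map_def algebra_simps)
  then have "complex_of_real (3 - d\<^sup>2) * (v - w) = - (2 * d * l * cnj (v - w))"
    by (simp add: conic_map_def eq_neg_iff_add_eq_0)
  then have "cmod (complex_of_real (3 - d\<^sup>2) * (v - w)) = cmod (2 * d * l * cnj (v - w))"
    by (metis norm_minus_cancel)
  then have e: "\<bar>3 - d\<^sup>2\<bar> * cmod (v - w) = 2 * d * cmod (v - w)"
    using assms complex_mod_cnj[of "v - w"] by (simp add: norm_mult del: of_real_diff)
  have "d^2 < 1" using assms by (simp add: power_less_one_iff)
  with e assms show ?thesis by auto
qed

lemma conic_uniqueness: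
  fixes d a k1 k2 k3 :: real and z1 z2 z3 c m l :: complex
  defines "l \<equiv> z1 * z2 * z3"
  assumes u: "cmod z1 = 1" "cmod z2 = 1" "cmod z3 = 1"
    and nc: "Im (cnj (z2 - z1) * (z3 - z1)) \<noteq> 0"
    and d: "0 \<le> d" "d < 1" and a: "a > 0"
    and b: "bisector_point z1 z2 z3 d" "bisector_point z2 z1 z3 d" "bisector_point z3 z1 z2 d"
    and n: "a * (z1 - c) + m * cnj (z1 - c) = k1 * (z1 - d)"
      "a * (z2 - c) + m * cnj (z2 - c) = k2 * (z2 - d)"
      "a * (z3 - c) + m * cnj (z3 - c) = k3 * (z3 - d)"
    and q: "Re (cnj (z1 - c) * (k1 * (z1 - d))) = K"
      "Re (cnj (z2 - c) * (k2 * (z2 - d))) = K"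
      "Re (cnj (z3 - c) * (k3 * (z3 - d))) = K"
  shows "\<exists>s>0. a = s * (3 - d\<^sup>2) \<and> m = s * (2 * d * l) \<and> c = conic_centre d l \<and> K = s * conic_level d l"
    and "poncelet_root d l z1" "poncelet_root d l z2" "poncelet_root d l z3"
proof -
  have ne: "z1 \<noteq> z2" "z1 \<noteq> z3" "z2 \<noteq> z3"
    using nc by (auto simp: algebra_simps)
  show p1: "poncelet_root d l z1"
    using bisector_imp_poncelet_root[OF u(1) u(2) u(3) _ _ b(1)] ne by (simp add: l_def)
  show p2: "poncelet_root d l z2"
    using bisector_imp_poncelet_root[OF u(2) u(1) u(3) _ _ b(2)] ne by (simp add: l_def mult_ac)
  show p3: "poncelet_root d l z3"
    using bisector_imp_poncelet_root[OF u(3) u(1) u(2) _ _ b(3)] ne by (simp add: l_def mult_ac)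
  have l1: "cmod l = 1" using u by (simp add: l_def norm_mult)
  define c' where "c' = conic_centre d l"
  define a' where "a' = 3 - d\<^sup>2"
  define m' where "m' = 2 * d * l"
  have a': "a' > 0" using d unfolding a'_def by (simp add: power_less_one_iff less_trans[of _ 1])
  have N: "conic_map d l w = a' * w + m' * cnj w" for w :: complex
    by (simp add: conic_map_def a'_def m'_def)
  have n': "a' * (z - c') + m' * cnj (z - c') = normal_factor d z * (z - d)"
    and q': "Re (cnj (z - c') * (normal_factor d z * (z - d))) = conic_level d l"
    if "poncelet_root d l z" for z :: complex
    using conic_level_vertex[OF that d] conic_map_vertex(1)[OF that d]
    unfolding N[symmetric] c'_def by (simp_all only:)
  have i2: "Im (cnj (z1 - z2) * (z3 - z2)) \<noteq> 0" and i3: "Im (cnj (z1 - z3) * (z2 - z3)) \<noteq> 0"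
    using nc by (simp_all add: algebra_simps)
  \<comment> \<open>The common factor of the two gradient fields, read off at the first vertex and
    carried to the others along the chords.\<close>
  define s where "s = k1 / normal_factor d z1"
  have nf: "normal_factor d z1 > 0" using normal_factor_pos u d by blast
  have s1: "k1 = s * normal_factor d z1" using nf by (simp add: s_def)
  have s2: "k2 = s * normal_factor d z2"
    unfolding s_def
    by (rule gradient_ratio[OF n(1) n'[OF p1] n(2) n'[OF p2]])
      (use q q'[OF p1] q'[OF p2] nf bisector_inner_pos[OF b(2) i2] in auto)
  have s3: "k3 = s * normal_factor d z3"
    unfolding s_def
    by (rule gradient_ratio[OF n(1) n'[OF p1] n(3) n'[OF p3]])
      (use q q'[OF p1] q'[OF p3] nf bisector_inner_pos[OF b(3) i3] in auto)
  have n2: "a * (z1 - c) + m * cnj (z1 - c) = s * (a' * (z1 - c') + m' * cnj (z1 - c'))"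
    "a * (z2 - c) + m * cnj (z2 - c) = s * (a' * (z2 - c') + m' * cnj (z2 - c'))"
    "a * (z3 - c) + m * cnj (z3 - c) = s * (a' * (z3 - c') + m' * cnj (z3 - c'))"
    using n n'[OF p1] n'[OF p2] n'[OF p3] s1 s2 s3 by simp_all
  \<comment> \<open>Differences between vertices eliminate both centres. The two chords are
    independent by \<open>nc\<close>, so the linear parts must agree.\<close>
  have h2: "(a - s * a') * (z2 - z1) + (m - s * m') * cnj (z2 - z1) = 0"
    using n2(1,2) unfolding complex_cnj_diff of_real_diff of_real_mult by algebra
  have h3: "(a - s * a') * (z3 - z1) + (m - s * m') * cnj (z3 - z1) = 0"
    using n2(1,3) unfolding complex_cnj_diff of_real_diff of_real_mult by algebra
  have h2': "complex_of_real (a - s * a') * (z2 - z1) + (m - s * m') * cnj (z2 - z1) = 0"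
    and h3': "complex_of_real (a - s * a') * (z3 - z1) + (m - s * m') * cnj (z3 - z1) = 0"
    using h2 h3 by simp_all
  have sa: "a = s * a'" and sm: "m = s * m'" using real_linear_zero[OF nc h2' h3'] by auto
  have s0: "s > 0" using sa a a' by (simp add: zero_less_mult_iff)
  have "conic_map d l (z1 - c) = conic_map d l (z1 - c')"
    unfolding N using n2(1) s0 unfolding sa sm by (simp add: ring_distribs[symmetric] mult.assoc flip: distrib_left)
  then have cc: "c = c'" using conic_map_inj[OF _ l1 d] by (metis diff_diff_eq2 add_diff_cancel_left' diff_add_cancel)
  have "K = s * conic_level d l"
    unfolding q(1)[symmetric] q'[OF p1, symmetric] cc s1 by (simp add: algebra_simps)
  then show "\<exists>s>0. a = s * (3 - d\<^sup>2) \<and> m = s * (2 * d * l) \<and> c = conic_centre d l \<and> K = s * conic_level d l"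
    using s0 sa sm cc by (auto simp: a'_def m'_def c'_def)
qed

subsection \<open>Poncelet closure for triangles\<close>

text \<open>The relation says that \<open>d\<close> lies on the chord from \<open>u\<close> to
  \<open>z3\<close>. In a poristic triangle this makes \<open>u\<close> the second intersection of
  the bisector at \<open>z3\<close> with the circle, the midpoint of the arc opposite
  \<open>z3\<close>, and so the outward normal of the opposite side. The relation is symmetric in
  \<open>u\<close> and \<open>z3\<close>. The strict inequality puts \<open>z3\<close> on the inner
  side of the tangent to the incircle with normal \<open>u\<close>.\<close>

lemma poncelet_third_vertex:
  fixes u z3 :: complex
  assumes u: "cmod u = 1" and d: "0 \<le> d" "d < 1" and z3: "z3 * (1 - d * u) = d - u"
  shows "cmod z3 = 1" "Re (z3 * cnj u) < d * Re u + (1 - d\<^sup>2) / 2"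
    "u * (1 - d * z3) = d - z3"
proof -
  note ne = pole_and_centre_ne_0[OF u d]
  show f: "u * (1 - d * z3) = d - z3" using z3 by (simp add: algebra_simps)
  have uu: "u * cnj u = 1" using unit_mult_cnj[OF u] .
  have flip: "1 - d * u = u * cnj (u - d)" using uu by (simp add: algebra_simps)
  have m: "cmod (1 - d * u) = cmod (u - d)"
    unfolding flip norm_mult complex_mod_cnj u by simp
  have "cmod z3 * cmod (1 - d * u) = cmod (d - u)" using z3 by (metis norm_mult)
  then show z1: "cmod z3 = 1" using ne m by (simp add: norm_minus_commute)
  obtain a b where ab: "a = Re u" "b = Im u" by simp
  have s: "a\<^sup>2 + b\<^sup>2 = 1" using u cmod_power2[of u] by (simp add: ab)
  have ale: "a \<le> 1" using complex_Re_le_cmod[of u] u by (simp add: ab)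
  define q where "q = cmod (1 - d * u)"
  have q: "q^2 = 1 + d\<^sup>2 - 2 * d * a"
    using s unfolding q_def cmod_power2 by (simp add: ab[symmetric]) algebra
  have qpos: "q > 0" using ne by (simp add: q_def)
  have "z3 * cnj u * q^2 = (z3 * (1 - d * u)) * cnj u * cnj (1 - d * u)"
    unfolding q_def of_real_power[symmetric] complex_norm_square by (simp only: mult_ac)
  also have "\<dots> = (d - u) * cnj u * cnj (1 - d * u)" unfolding z3 ..
  also have "\<dots> = - (cnj (1 - d * u))\<^sup>2" using uu unfolding complex_cnj_diff by simp algebra
  finally have "z3 * cnj u * complex_of_real (q^2) = - (cnj (1 - d * u))\<^sup>2" by simp
  then have "Re (z3 * cnj u * complex_of_real (q^2)) = Re (- (cnj (1 - d * u))\<^sup>2)" by (rule arg_cong)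
  then have "Re (z3 * cnj u) * q^2 = - ((1 - d * a)\<^sup>2 - (d * b)\<^sup>2)"
    by (simp del: of_real_power complex_cnj_diff add: Re_power2 ab algebra_simps)
  then have r: "Re (z3 * cnj u) * q^2 = 2 * d * a - 1 - d\<^sup>2 * (a\<^sup>2 - b\<^sup>2)"
    by algebra
  have b2: "a\<^sup>2 - b\<^sup>2 = 2 * a\<^sup>2 - 1" using s by simp
  have "(d * a + (1 - d\<^sup>2) / 2 - Re (z3 * cnj u)) * q^2 * 2
      = (2 * d * a + 1 - d\<^sup>2) * q^2 - 2 * (Re (z3 * cnj u) * q^2)" by (simp add: field_simps)
  also have "\<dots> = (1 - d\<^sup>2) * (3 + d\<^sup>2 - 4 * d * a)"
    unfolding r unfolding q b2 by algebra
  finally have "(d * a + (1 - d\<^sup>2) / 2 - Re (z3 * cnj u)) * q^2 * 2 = (1 - d\<^sup>2) * (3 + d\<^sup>2 - 4 * d * a)" .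
  \<comment> \<open>The extreme case \<open>a = 1\<close> gives
    \<open>(1 - d) * (3 - d)\<close>.\<close>
  moreover have "3 + d\<^sup>2 - 4 * d * a > 0"
  proof -
    have "d * a \<le> d" using ale d by (simp add: mult_left_le)
    moreover have "(1 - d) * (3 - d) > 0" using d by simp
    ultimately show ?thesis by (simp add: algebra_simps power2_eq_square)
  qed
  moreover have "1 - d\<^sup>2 > 0" using d by (simp add: power_less_one_iff)
  ultimately have "(d * a + (1 - d\<^sup>2) / 2 - Re (z3 * cnj u)) * q^2 * 2 > 0" by simp
  then have "d * a + (1 - d\<^sup>2) / 2 - Re (z3 * cnj u) > 0"
    using qpos by (simp add: zero_less_mult_iff)
  then show "Re (z3 * cnj u) < d * Re u + (1 - d\<^sup>2) / 2" by (simp add: ab)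
qed

text \<open>Multiplication by \<open>z * u\<close> clears the conjugates. The points where a line
  with normal \<open>u\<close> meets the circle thus become the roots of a quadratic with sum
  \<open>2 * h * u\<close> and product \<open>u^2\<close>.\<close>

lemma unit_chord_iff:
  fixes z u :: complex
  assumes "cmod z = 1" "cmod u = 1"
  shows "Re (z * cnj u) = h \<longleftrightarrow> z\<^sup>2 + u\<^sup>2 = complex_of_real (2 * h) * u * z"
proof -
  have zz: "z * cnj z = 1" and uu: "u * cnj u = 1" using assms unit_mult_cnj by auto
  have "z * cnj u + cnj z * u = complex_of_real (2 * Re (z * cnj u))"
    using complex_add_cnj[of "z * cnj u"] by simp
  then have "Re (z * cnj u) = h \<longleftrightarrow> z * cnj u + cnj z * u = complex_of_real (2 * h)"
    by (simp only: of_real_eq_iff) linarith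
  also have "\<dots> \<longleftrightarrow> z * u * (z * cnj u + cnj z * u) = z * u * complex_of_real (2 * h)"
    using assms by (metis mult_cancel_left mult_eq_0_iff norm_zero zero_neq_one)
  also have "z * u * (z * cnj u + cnj z * u) = z\<^sup>2 + u\<^sup>2" using zz uu by algebra
  finally show ?thesis by (simp add: mult_ac)
qed

text \<open>The tangent to the incircle with outward normal \<open>u\<close> lies at signed distance
  \<open>h\<close> from the origin and meets the circle at \<open>u * w\<close> and
  \<open>u * cnj w\<close>, where \<open>Re w = h\<close>. The third vertex is the other end of the
  chord from \<open>u\<close> through \<open>d\<close>, and the level is the product
  \<open>u^2 * z3\<close>.\<close>

lemma poncelet_triangle_exists:
  fixes u :: complex
  assumes u: "cmod u = 1" and d: "0 \<le> d" "d < 1"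
  obtains l z1 z2 z3 where "poncelet_root d l z1" "poncelet_root d l z2" "poncelet_root d l z3"
    "z1 \<noteq> z2" "z1 \<noteq> z3" "z2 \<noteq> z3"
    "Re (z1 * cnj u) = d * Re u + (1 - d\<^sup>2) / 2" "Re (z2 * cnj u) = d * Re u + (1 - d\<^sup>2) / 2"
proof -
  define h where "h = d * Re u + (1 - d\<^sup>2) / 2"
  define w where "w = Complex h (sqrt (1 - h\<^sup>2))"
  have re: "\<bar>Re u\<bar> \<le> 1" using u abs_Re_le_cmod[of u] by simp
  have dre: "\<bar>d * Re u\<bar> \<le> d" using re d by (simp add: abs_mult mult_left_le)
  have "(1 - d)\<^sup>2 > 0" "(1 - d) * (3 + d) > 0" using d by simp_all
  then have "d + (1 - d\<^sup>2) / 2 < 1" "- 1 < - d + (1 - d\<^sup>2) / 2" by (simp_all add: power2_eq_square field_simps)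
  then have "\<bar>h\<bar> < 1" using dre unfolding h_def abs_le_iff abs_less_iff by linarith
  then have h1: "h\<^sup>2 < 1" by (simp add: abs_square_less_1)
  have w1: "cmod w = 1" using h1 by (simp add: w_def cmod_def)
  have ww: "w * cnj w = 1" using unit_mult_cnj[OF w1] .
  have w2: "w \<noteq> cnj w" using h1 by (simp add: w_def complex_eq_iff)
  have wh: "w + cnj w = 2 * h" by (simp add: complex_add_cnj w_def)
  define z1 z2 z3 where "z1 = u * w" and "z2 = u * cnj w" and "z3 = (d - u) / (1 - d * u)"
  note ne = pole_and_centre_ne_0[OF u d]
  have z3: "z3 * (1 - d * u) = d - u" using ne by (simp add: z3_def)
  note t = poncelet_third_vertex[OF u d z3]
  have uu: "u * cnj u = 1" using unit_mult_cnj[OF u] .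
  have c: "cmod z1 = 1" "cmod z2 = 1" using u w1 by (simp_all add: z1_def z2_def norm_mult)
  have r1: "Re (z1 * cnj u) = h" "Re (z2 * cnj u) = h"
  proof -
    have "z1 * cnj u = w" "z2 * cnj u = cnj w" using uu unfolding z1_def z2_def by algebra+
    then show "Re (z1 * cnj u) = h" "Re (z2 * cnj u) = h" by (simp_all add: w_def)
  qed
  have "complex_of_real (2 * Re u) = u + cnj u" by (simp add: complex_add_cnj)
  then have h2: "2 * h * u = d * (u\<^sup>2 + 1) + (1 - d\<^sup>2) * u"
  proof -
    have "2 * h * u = (d * complex_of_real (2 * Re u) + (1 - complex_of_real d ^ 2)) * u"
      by (simp add: h_def field_simps)
    also have "\<dots> = (d * (u + cnj u) + (1 - complex_of_real d ^ 2)) * u"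
      by (simp only: complex_add_cnj)
    also have "\<dots> = d * (u\<^sup>2 + 1) + (1 - complex_of_real d ^ 2) * u" using uu by algebra
    finally show ?thesis by simp
  qed
  \<comment> \<open>Multiplied by \<open>1 - D * u\<close>, the cubic of level
    \<open>u^2 * z3\<close> splits into the quadratic of the tangent chord and the linear equation
    of the third vertex.\<close>
  have root: "poncelet_root d (u\<^sup>2 * z3) z" if "cmod z = 1" "Re (z * cnj u) = h" for z :: complex
  proof -
    have q: "z\<^sup>2 + u\<^sup>2 = 2 * h * u * z" using that(2) unit_chord_iff[OF that(1) u, of h] by blast
    define D where "D = complex_of_real d"
    have q': "z\<^sup>2 + u\<^sup>2 = (D * (u\<^sup>2 + 1) + (1 - D^2) * u) * z"
      by (simp only: q h2 D_def of_real_diff of_real_1 of_real_power)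
    have "(z * (z - D)\<^sup>2) * (1 - D * u) - (u\<^sup>2 * (D - u)) * (1 - D * z)\<^sup>2
       = (z\<^sup>2 + u\<^sup>2 - (D * (u\<^sup>2 + 1) + (1 - D^2) * u) * z) * (z * (1 - D * u) - (D - u))"
      by algebra
    then have "(z * (z - D)\<^sup>2) * (1 - D * u) = (u\<^sup>2 * (D - u)) * (1 - D * z)\<^sup>2" using q' by simp
    also have "\<dots> = (u\<^sup>2 * z3) * (1 - D * z)\<^sup>2 * (1 - D * u)"
      unfolding z3[folded D_def, symmetric] by (simp only: mult_ac)
    finally have "z * (z - D)\<^sup>2 = (u\<^sup>2 * z3) * (1 - D * z)\<^sup>2" using ne by (simp add: D_def)
    then show ?thesis using that by (simp add: poncelet_root_def D_def)
  qed
  have "poncelet_root d (u\<^sup>2 * z3) z3"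
  proof -
    have "z3 * (z3 - d)\<^sup>2 = z3 * (u * (1 - d * z3))\<^sup>2" unfolding t(3) by (simp add: power2_commute)
    then show ?thesis using t(1) by (simp add: poncelet_root_def power_mult_distrib)
  qed
  moreover have "z1 \<noteq> z2" using w2 u by (auto simp: z1_def z2_def)
  moreover have "z1 \<noteq> z3" "z2 \<noteq> z3" using t(2) r1 by (auto simp: h_def)
  ultimately show thesis using that root[OF c(1) r1(1)] root[OF c(2) r1(2)] r1 unfolding h_def by metis
qed

text \<open>With \<open>u\<close> the other end of the chord from \<open>z3\<close> through
  \<open>d\<close>, Vieta's formulas give \<open>z1 * z2 = u^2\<close> and
  \<open>z1 + z2 = 2 * h * u\<close>. These are the product and the sum that belong to the tangent
  line with normal \<open>u\<close>.\<close>

lemma poncelet_side: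
  assumes z: "poncelet_root d l z1" "poncelet_root d l z2" "poncelet_root d l z3"
    and ne: "z1 \<noteq> z2" "z1 \<noteq> z3" "z2 \<noteq> z3" and d: "0 \<le> d" "d < 1"
  obtains u where "cmod u = 1" "Re (z1 * cnj u) = d * Re u + (1 - d\<^sup>2) / 2"
    "Re (z2 * cnj u) = d * Re u + (1 - d\<^sup>2) / 2" "Re (z3 * cnj u) < d * Re u + (1 - d\<^sup>2) / 2"
proof -
  have c: "cmod z1 = 1" "cmod z2 = 1" "cmod z3 = 1" using z by (auto simp: poncelet_root_def)
  define u where "u = (d - z3) / (1 - d * z3)"
  note nz = pole_and_centre_ne_0[OF c(3) d]
  have u: "u * (1 - d * z3) = d - z3" using nz by (simp add: u_def)
  note t = poncelet_third_vertex[OF c(3) d u]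
  have uu: "u * cnj u = 1" using unit_mult_cnj[OF t(1)] .
  have "z3 * u\<^sup>2 * (1 - d * z3)\<^sup>2 = z3 * (d - z3)\<^sup>2" using u by algebra
  also have "\<dots> = l * (1 - d * z3)\<^sup>2" using z(3) by (simp add: poncelet_root_def power2_commute)
  finally have l: "l = z3 * u\<^sup>2" using nz by simp
  have "z1 * z2 = u\<^sup>2" using poncelet_root_vieta(1)[OF z ne] l c by auto
  define h where "h = d * Re u + (1 - d\<^sup>2) / 2"
  have h2: "2 * h * u = d * (u\<^sup>2 + 1) + (1 - complex_of_real d ^ 2) * u"
  proof -
    have "2 * h * u = (d * complex_of_real (2 * Re u) + (1 - complex_of_real d ^ 2)) * u"
      by (simp add: h_def field_simps)
    also have "\<dots> = (d * (u + cnj u) + (1 - complex_of_real d ^ 2)) * u"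
      by (simp only: complex_add_cnj)
    also have "\<dots> = d * (u\<^sup>2 + 1) + (1 - complex_of_real d ^ 2) * u" using uu by algebra
    finally show ?thesis by simp
  qed
  \<comment> \<open>The product subtracted in the second equation below is zero by the defining
    relation of \<open>u\<close>; adding it makes that equation a polynomial identity.\<close>
  have s: "z1 + z2 = 2 * h * u"
  proof -
    have "z1 + z2 = 2 * d + z3 * u\<^sup>2 * complex_of_real d ^ 2 - z3"
      using poncelet_root_vieta(2)[OF z ne] l by (simp add: algebra_simps)
    also have "\<dots> = (d * (u\<^sup>2 + 1) + (1 - complex_of_real d ^ 2) * u) - (1 + d * u) * (u * (1 - d * z3) - (d - z3))"
      unfolding of_real_mult of_real_numeral by algebra
    also have "\<dots> = 2 * h * u" using u h2 by simp
    finally show ?thesis .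
  qed
  have "z1\<^sup>2 + u\<^sup>2 = 2 * h * u * z1" "z2\<^sup>2 + u\<^sup>2 = 2 * h * u * z2"
    using s \<open>z1 * z2 = u\<^sup>2\<close> by algebra+
  then have "Re (z1 * cnj u) = h" "Re (z2 * cnj u) = h"
    using unit_chord_iff[OF c(1) t(1)] unit_chord_iff[OF c(2) t(1)] by simp_all
  moreover have "Re (z3 * cnj u) < h"
    using poncelet_third_vertex(2)[OF t(1) d t(3)] by (simp add: h_def)
  ultimately show thesis using that[OF t(1)] by (simp add: h_def)
qed

text \<open>The chord with normal \<open>u\<close> fixes two vertices; the third is recovered from Vieta's formulas.\<close>

lemma poncelet_triangle_unique:
  assumes z: "poncelet_root d l z1" "poncelet_root d l z2" "poncelet_root d l z3"
    "z1 \<noteq> z2" "z1 \<noteq> z3" "z2 \<noteq> z3"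
    and w: "poncelet_root d m w1" "poncelet_root d m w2" "poncelet_root d m w3"
    "w1 \<noteq> w2" "w1 \<noteq> w3" "w2 \<noteq> w3"
    and d: "0 \<le> d" "d < 1" and u: "cmod u = 1"
    and h: "Re (z1 * cnj u) = h" "Re (z2 * cnj u) = h" "Re (w1 * cnj u) = h" "Re (w2 * cnj u) = h"
  shows "{z1, z2, z3} = {w1, w2, w3}"
proof -
  have c: "cmod z1 = 1" "cmod z2 = 1" "cmod w1 = 1" "cmod w2 = 1"
    using z w by (auto simp: poncelet_root_def)
  have q: "z1\<^sup>2 + u\<^sup>2 = 2 * h * u * z1" "z2\<^sup>2 + u\<^sup>2 = 2 * h * u * z2"
    "w1\<^sup>2 + u\<^sup>2 = 2 * h * u * w1" "w2\<^sup>2 + u\<^sup>2 = 2 * h * u * w2"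
    using h unit_chord_iff[OF c(1) u, of h] unit_chord_iff[OF c(2) u, of h]
      unit_chord_iff[OF c(3) u, of h] unit_chord_iff[OF c(4) u, of h] by blast+
  have "(z1 - z2) * (z1 + z2 - 2 * h * u) = 0" using q(1,2) by algebra
  then have s: "z1 + z2 = 2 * h * u" using z by simp
  have "(w1 - z1) * (w1 - z2) = 0" "(w2 - z1) * (w2 - z2) = 0" using q s by algebra+
  then have two: "w1 = z1 \<and> w2 = z2 \<or> w1 = z2 \<and> w2 = z1" using w(4) by auto
  then have "poncelet_root d m z1" using w by auto
  then have "m * (1 - d * z1)\<^sup>2 = l * (1 - d * z1)\<^sup>2" using z(1) by (simp add: poncelet_root_def)
  then have "l = m" using pole_and_centre_ne_0(1)[OF c(1) d] by (metis mult_cancel_right power_not_zero)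
  then have "w1 + w2 + w3 = z1 + z2 + z3"
    using poncelet_root_vieta(2)[OF z] poncelet_root_vieta(2)[OF w] by simp
  then have "w3 = z3" using two by auto
  then show ?thesis using two by auto
qed

subsection \<open>The Euclidean plane as the complex plane\<close>

definition cvec :: "complex \<Rightarrow> real^2" where
  "cvec z = vector [Re z, Im z]"

lemma cvec_nth [simp]: "cvec z $ 1 = Re z" "cvec z $ 2 = Im z"
  by (simp_all add: cvec_def)

lemma cvec_eq_iff [simp]: "cvec z = cvec w \<longleftrightarrow> z = w"
  by (simp add: vec_eq_iff forall_2 complex_eq_iff)

lemma cvec_surj: obtains z where "X = cvec z"
  by (rule that[of "Complex (X $ 1) (X $ 2)"]) (simp add: vec_eq_iff forall_2)

lemma cvec_arith:
  "cvec z + cvec w = cvec (z + w)" "cvec z - cvec w = cvec (z - w)" "k *\<^sub>R cvec z = cvec (k *\<^sub>R z)"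
  by (simp_all add: vec_eq_iff forall_2)

lemma cvec_inner: "cvec z \<bullet> cvec w = Re (z * cnj w)"
  by (simp add: inner_vec_def sum_2)

lemma cvec_norm: "norm (cvec z) = cmod z"
  by (simp add: norm_eq_sqrt_inner[of "cvec z"] cvec_inner cmod_def power2_eq_square)

lemma cvec_dist: "dist (cvec z) (cvec w) = cmod (z - w)"
  by (simp add: dist_norm cvec_arith cvec_norm)

text \<open>\<open>Im (cnj e * f)\<close> is the determinant of the vectors e and f, here twice the
  signed area of the triangle.\<close>

lemma collinear_cvec:
  "collinear {cvec a, cvec b, cvec c} \<longleftrightarrow> Im (cnj (b - a) * (c - a)) = 0"
proof
  assume "collinear {cvec a, cvec b, cvec c}"
  then consider "a = c" | u where "b = u *\<^sub>R a + (1 - u) *\<^sub>R c"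
    unfolding collinear_3_expand cvec_arith cvec_eq_iff by blast
  then show "Im (cnj (b - a) * (c - a)) = 0"
  proof cases
    case 2
    then have "b - a = (1 - u) *\<^sub>R (c - a)" by (simp add: algebra_simps)
    then show ?thesis by (simp del: complex_cnj_diff) (simp add: algebra_simps)
  qed simp
next
  assume im: "Im (cnj (b - a) * (c - a)) = 0"
  show "collinear {cvec a, cvec b, cvec c}"
  proof (cases "a = c")
    case False
    define t where "t = Re (cnj (b - a) * (c - a)) / (cmod (c - a))\<^sup>2"
    have n: "(cmod (c - a))\<^sup>2 \<noteq> 0" using False by simp
    have "cnj (b - a) * (c - a) = complex_of_real (Re (cnj (b - a) * (c - a)))"
      using im by (simp add: complex_eq_iff)
    then have "(b - a) * cnj (c - a) = complex_of_real (Re (cnj (b - a) * (c - a)))"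
      by (metis complex_cnj_cnj complex_cnj_complex_of_real complex_cnj_mult)
    also have "\<dots> = complex_of_real t * complex_of_real ((cmod (c - a))\<^sup>2)"
      unfolding of_real_mult[symmetric] using n by (simp add: t_def)
    also have "\<dots> = complex_of_real t * (c - a) * cnj (c - a)"
      unfolding complex_norm_square by simp
    finally have "b - a = t *\<^sub>R (c - a)" using False by (simp add: scaleR_conv_of_real)
    then have "b = (1 - t) *\<^sub>R a + (1 - (1 - t)) *\<^sub>R c" by (simp add: algebra_simps)
    then show ?thesis unfolding collinear_3_expand cvec_arith cvec_eq_iff by blast
  qed (simp add: collinear_3_expand)
qed

section \<open>Tangent lines and incircles in complex coordinates\<close>

lemma tangent_line_orthogonal:
  fixes A B c P :: "real^2"
  assumes t: "tangent_to_circle_at (affine hull {A, B}) c \<rho> P" and ne: "A \<noteq> B"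
  shows "dist c P = \<rho>" "(A - P) \<bullet> (P - c) = 0" "(B - P) \<bullet> (P - c) = 0"
proof -
  have eq: "affine hull {A, B} \<inter> sphere c \<rho> = {P}" using t by (simp add: tangent_to_circle_at_def)
  then have P: "P \<in> affine hull {A, B}" and d: "dist c P = \<rho>" by auto
  then show "dist c P = \<rho>" by simp
  define w where "w = B - A"
  obtain s where s: "P = A + s *\<^sub>R w"
    using P unfolding affine_hull_2_alt w_def by auto
  have ww: "w \<bullet> w > 0" using ne by (simp add: w_def)
  \<comment> \<open>\<open>Q\<close> is the mirror image of \<open>P\<close> in the foot of the
    perpendicular from \<open>c\<close>. It lies on the line and on the circle, so tangency, defined
    by a single common point, forces \<open>Q = P\<close>.\<close>
  define r where "r = - 2 * ((P - c) \<bullet> w) / (w \<bullet> w)"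
  define Q where "Q = P + r *\<^sub>R w"
  have "Q = A + (s + r) *\<^sub>R w" by (simp add: Q_def s algebra_simps)
  then have Qa: "Q \<in> affine hull {A, B}" unfolding affine_hull_2_alt w_def by auto
  have "(Q - c) \<bullet> (Q - c) = (P - c) \<bullet> (P - c) + r * (2 * ((P - c) \<bullet> w) + r * (w \<bullet> w))"
    by (simp add: Q_def algebra_simps inner_commute)
  also have "2 * ((P - c) \<bullet> w) + r * (w \<bullet> w) = 0" using ww by (simp add: r_def)
  finally have "norm (Q - c) = norm (P - c)" by (simp add: norm_eq_sqrt_inner)
  then have "Q \<in> sphere c \<rho>" using d by (simp add: dist_norm norm_minus_commute)
  then have "Q = P" using eq Qa by blast
  then have "r = 0" using ww by (auto simp: Q_def)
  then have o: "w \<bullet> (P - c) = 0" using ww by (simp add: r_def inner_commute)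
  have a: "A - P = (- s) *\<^sub>R w" "B - P = (1 - s) *\<^sub>R w" by (simp_all add: s w_def algebra_simps)
  show "(A - P) \<bullet> (P - c) = 0" "(B - P) \<bullet> (P - c) = 0" unfolding a using o by simp_all
qed

lemma tangent_side_imp:
  assumes t: "tangent_to_circle_at (affine hull {cvec a, cvec b}) (cvec x) \<rho> (cvec p)"
    and ne: "a \<noteq> b" and \<rho>: "\<rho> > 0"
  obtains u where "cmod u = 1" "p = x + \<rho> * u" "Re ((a - x) * cnj u) = \<rho>" "Re ((b - x) * cnj u) = \<rho>"
proof -
  have ne': "cvec a \<noteq> cvec b" using ne by simp
  note l = tangent_line_orthogonal[OF t ne']
  define u where "u = (p - x) / \<rho>"
  have pu: "p = x + \<rho> * u" using \<rho> by (simp add: u_def)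
  have "cmod (x - p) = \<rho>" using l(1) by (simp add: cvec_dist)
  then have u: "cmod u = 1" using \<rho> pu by (simp add: norm_mult)
  have h: "Re ((z - x) * cnj u) = \<rho>" if "(cvec z - cvec p) \<bullet> (cvec p - cvec x) = 0" for z
  proof -
    have "Re ((z - p) * cnj (\<rho> * u)) = 0" using that pu by (simp add: cvec_arith cvec_inner)
    moreover have "Re ((z - p) * cnj (\<rho> * u)) = \<rho> * Re ((z - p) * cnj u)"
      by (simp add: algebra_simps)
    ultimately have z: "Re ((z - p) * cnj u) = 0" using \<rho> by simp
    have "(z - x) * cnj u = (z - p) * cnj u + \<rho> * (u * cnj u)" by (simp add: pu algebra_simps)
    also have "\<dots> = (z - p) * cnj u + \<rho>" using unit_mult_cnj[OF u] by simp
    finally show ?thesis using z by simp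
  qed
  show thesis using that[OF u pu h[OF l(2)] h[OF l(3)]] .
qed

lemma tangent_sideI:
  assumes ne: "a \<noteq> b" and u: "cmod u = 1" and \<rho>: "\<rho> > 0"
    and h: "Re ((a - x) * cnj u) = \<rho>" "Re ((b - x) * cnj u) = \<rho>"
  shows "tangent_to_circle_at (affine hull {cvec a, cvec b}) (cvec x) \<rho> (cvec (x + \<rho> * u))"
proof -
  have uu: "u * cnj u = 1" using unit_mult_cnj[OF u] .
  have mem: "cvec z \<in> affine hull {cvec a, cvec b} \<longleftrightarrow> (\<exists>t. z = a + t *\<^sub>R (b - a))" for z
    unfolding affine_hull_2_alt by (auto simp: cvec_arith)
  have e0: "Re ((b - a) * cnj u) = 0" using h by (simp add: algebra_simps)
  define k where "k = Im ((b - a) * cnj u)"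
  have ba: "b - a = (\<i> * k) * u"
  proof -
    have "(b - a) * cnj u = \<i> * k" using e0 by (simp add: k_def complex_eq_iff)
    then show ?thesis using uu by (metis mult.assoc mult.commute mult.right_neutral)
  qed
  then have k: "k \<noteq> 0" using ne by auto
  have "cvec (x + \<rho> * u) \<in> affine hull {cvec a, cvec b}"
  proof -
    define s where "s = Im ((a - x) * cnj u)"
    have "(a - x) * cnj u = \<rho> + \<i> * s" using h by (simp add: s_def complex_eq_iff)
    then have "a - x = (\<rho> + \<i> * s) * u" using uu by (metis mult.assoc mult.commute mult.right_neutral)
    then have a: "x + \<rho> * u = a - \<i> * s * u" by (simp add: algebra_simps)
    have "(- s / k) *\<^sub>R (b - a) = - \<i> * s * u" using k by (simp add: ba scaleR_conv_of_real)
    then have "x + \<rho> * u = a + (- s / k) *\<^sub>R (b - a)" using a by simp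
    then show ?thesis unfolding mem by blast
  qed
  moreover have "z = x + \<rho> * u" if z: "cvec z \<in> affine hull {cvec a, cvec b}" and s: "cmod (x - z) = \<rho>" for z
  proof -
    obtain t where t: "z = a + t *\<^sub>R (b - a)" using z mem by blast
    \<comment> \<open>After rotation by \<open>cnj u\<close> the line is the set of real part
      \<rho>, and its only point of modulus \<rho> is real.\<close>
    define w where "w = (z - x) * cnj u"
    have "w = (a - x) * cnj u + t *\<^sub>R ((b - a) * cnj u)" by (simp add: w_def t algebra_simps)
    then have re: "Re w = \<rho>" using h e0 by simp
    have "cmod w = \<rho>" using s u by (simp add: w_def norm_mult norm_minus_commute)
    then have "(Re w)\<^sup>2 + (Im w)\<^sup>2 = \<rho>\<^sup>2" using cmod_power2[of w] by simp
    then have "Im w = 0" using re by simp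
    then have "w = \<rho>" using re by (simp add: complex_eq_iff)
    then have "z - x = \<rho> * u" unfolding w_def using uu by (metis mult.assoc mult.commute mult.right_neutral)
    then show ?thesis by (simp add: algebra_simps)
  qed
  moreover have "cmod (x - (x + \<rho> * u)) = \<rho>" using u \<rho> by (simp add: norm_mult)
  ultimately have m: "cvec z \<in> affine hull {cvec a, cvec b} \<inter> sphere (cvec x) \<rho> \<longleftrightarrow> z = x + \<rho> * u" for z
    unfolding Int_iff mem_sphere cvec_dist by blast
  have "X \<in> affine hull {cvec a, cvec b} \<inter> sphere (cvec x) \<rho> \<longleftrightarrow> X = cvec (x + \<rho> * u)" for X
  proof -
    obtain z where "X = cvec z" by (rule cvec_surj)
    then show ?thesis using m by (simp only: cvec_eq_iff)
  qed
  then show ?thesis unfolding tangent_to_circle_at_def by blast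
qed

lemma plane_coordinates:
  fixes e f w :: complex
  assumes "Im (cnj e * f) \<noteq> 0"
  shows "w = (Im (cnj w * f) / Im (cnj e * f)) *\<^sub>R e + (Im (cnj e * w) / Im (cnj e * f)) *\<^sub>R f"
proof -
  define N where "N = Im (cnj e * f)"
  have "N *\<^sub>R w = Im (cnj w * f) *\<^sub>R e + Im (cnj e * w) *\<^sub>R f"
    by (simp add: N_def complex_eq_iff algebra_simps)
  then have "(1 / N) *\<^sub>R (N *\<^sub>R w) = (1 / N) *\<^sub>R (Im (cnj w * f) *\<^sub>R e + Im (cnj e * w) *\<^sub>R f)" by simp
  then show ?thesis using assms unfolding N_def[symmetric] by (simp add: scaleR_add_right)
qed

lemma tangent_area:
  assumes u: "cmod u = 1" and h: "Re ((a - x) * cnj u) = \<rho>" "Re ((b - x) * cnj u) = \<rho>"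
  shows "\<bar>Im (cnj (b - a) * (x - a))\<bar> = \<bar>\<rho>\<bar> * cmod (b - a)"
proof -
  have uu: "u * cnj u = 1" using unit_mult_cnj[OF u] .
  define k where "k = Im ((b - a) * cnj u)"
  have e: "(b - a) * cnj u = \<i> * k" using h by (simp add: k_def complex_eq_iff algebra_simps)
  define s where "s = Im ((x - a) * cnj u)"
  have g: "(x - a) * cnj u = - \<rho> + \<i> * s" using h by (simp add: s_def complex_eq_iff algebra_simps)
  have "cnj (b - a) * (x - a) = cnj ((b - a) * cnj u) * ((x - a) * cnj u)"
    using uu unfolding complex_cnj_mult complex_cnj_cnj by algebra
  then have "cnj (b - a) * (x - a) = - \<i> * k * (- \<rho> + \<i> * s)" unfolding e g by simp
  then have 1: "Im (cnj (b - a) * (x - a)) = k * \<rho>" by simp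
  have "cmod (b - a) = cmod ((b - a) * cnj u)" using u by (simp add: norm_mult)
  also have "\<dots> = \<bar>k\<bar>" unfolding e by (simp add: norm_mult)
  finally show ?thesis unfolding 1 by (simp add: abs_mult)
qed

text \<open>The incentre has distance \<rho> from both sides at \<open>a\<close>, so comparing areas
  makes its barycentric weights at \<open>b\<close> and \<open>c\<close> proportional to
  \<open>cmod (c - a)\<close> and \<open>cmod (b - a)\<close>. Membership in the convex hull makes
  the weights nonnegative, which selects the internal bisector among the two.\<close>

lemma incircle_imp_bisector_point:
  assumes tri: "is_triangle {cvec a, cvec b, cvec c}"
    and inc: "has_incircle {cvec a, cvec b, cvec c} (cvec x) \<rho>" and \<rho>: "\<rho> > 0"
  shows "bisector_point a b c x"
proof -
  have N0: "Im (cnj (b - a) * (c - a)) \<noteq> 0"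
    using tri collinear_cvec unfolding is_triangle_def by blast
  define N where "N = Im (cnj (b - a) * (c - a))"
  have ne: "a \<noteq> b" "a \<noteq> c" using N0 by auto
  have area: "\<bar>Im (cnj (z - a) * (x - a))\<bar> = \<rho> * cmod (z - a)" if "z \<in> {b, c}" for z
  proof -
    have az: "a \<noteq> z" using that ne by auto
    then have "affine hull {cvec a, cvec z} \<in> side_lines {cvec a, cvec b, cvec c}"
      using that unfolding side_lines_def by fastforce
    then obtain P where P: "tangent_to_circle_at (affine hull {cvec a, cvec z}) (cvec x) \<rho> P"
      using inc unfolding has_incircle_def by blast
    obtain p where "P = cvec p" by (rule cvec_surj)
    then obtain u where "cmod u = 1" "Re ((a - x) * cnj u) = \<rho>" "Re ((z - x) * cnj u) = \<rho>"
      using tangent_side_imp[OF _ az \<rho>] P by metis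
    then show ?thesis using tangent_area \<rho> by fastforce
  qed
  have "cvec x \<in> convex hull {cvec a, cvec b, cvec c}"
    using inc \<rho> unfolding has_incircle_def by (meson centre_in_cball less_imp_le subsetD)
  then obtain p q s where pq: "0 \<le> q" "0 \<le> s" "p + q + s = 1" "x = p *\<^sub>R a + q *\<^sub>R b + s *\<^sub>R c"
    unfolding convex_hull_3 by (auto simp: cvec_arith)
  have p: "p = 1 - q - s" using pq by simp
  have x: "x - a = q *\<^sub>R (b - a) + s *\<^sub>R (c - a)" unfolding pq(4) p by (simp add: algebra_simps)
  have "Im (cnj (b - a) * (x - a)) = s * N" unfolding x N_def by (simp add: algebra_simps)
  then have s: "s * \<bar>N\<bar> = \<rho> * cmod (b - a)" using area[of b] pq by (simp add: abs_mult)
  have "Im (cnj (c - a) * (x - a)) = - q * N" unfolding x N_def by (simp add: algebra_simps)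
  then have q: "q * \<bar>N\<bar> = \<rho> * cmod (c - a)" using area[of c] pq by (simp add: abs_mult)
  have N: "\<bar>N\<bar> > 0" using N0 by (simp add: N_def)
  have "x - a = (\<rho> / \<bar>N\<bar>) *\<^sub>R (cmod (c - a) *\<^sub>R (b - a) + cmod (b - a) *\<^sub>R (c - a))"
  proof -
    have "q = \<rho> / \<bar>N\<bar> * cmod (c - a)" "s = \<rho> / \<bar>N\<bar> * cmod (b - a)" using s q N by (simp_all add: field_simps)
    then show ?thesis unfolding x by (simp only: scaleR_add_right scaleR_scaleR)
  qed
  moreover have "\<rho> / \<bar>N\<bar> > 0" using N \<rho> by simp
  ultimately show ?thesis unfolding bisector_point_def by blast
qed

text \<open>Each side line bounds a half-plane that contains the disk. Its affine functional equals
  \<rho> at two vertices and is smaller at the third, so the bound \<rho> on the disk makes the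
  barycentric weight of the third vertex nonnegative.\<close>

lemma has_incircleI:
  assumes N: "Im (cnj (b - a) * (c - a)) \<noteq> 0" and \<rho>: "\<rho> > 0"
    and u: "cmod u = 1" "Re ((b - x) * cnj u) = \<rho>" "Re ((c - x) * cnj u) = \<rho>" "Re ((a - x) * cnj u) < \<rho>"
    and v: "cmod v = 1" "Re ((a - x) * cnj v) = \<rho>" "Re ((c - x) * cnj v) = \<rho>" "Re ((b - x) * cnj v) < \<rho>"
    and w: "cmod w = 1" "Re ((a - x) * cnj w) = \<rho>" "Re ((b - x) * cnj w) = \<rho>" "Re ((c - x) * cnj w) < \<rho>"
  shows "has_incircle {cvec a, cvec b, cvec c} (cvec x) \<rho>"
proof -
  have ne: "a \<noteq> b" "a \<noteq> c" "b \<noteq> c" using N by (auto simp: algebra_simps)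
  have "X \<in> convex hull {cvec a, cvec b, cvec c}" if X: "X \<in> cball (cvec x) \<rho>" for X
  proof -
    obtain y where y: "X = cvec y" by (rule cvec_surj)
    have yx: "cmod (y - x) \<le> \<rho>" using X y by (simp add: cvec_dist norm_minus_commute)
    have le: "Re ((y - x) * cnj z) \<le> \<rho>" if "cmod z = 1" for z
      using yx that complex_Re_le_cmod[of "(y - x) * cnj z"] by (metis complex_mod_cnj mult.right_neutral norm_mult order_trans)
    obtain q s where "y - a = q *\<^sub>R (b - a) + s *\<^sub>R (c - a)"
      using plane_coordinates[OF N] by blast
    then have yy: "y = (1 - q - s) *\<^sub>R a + q *\<^sub>R b + s *\<^sub>R c" by (simp add: algebra_simps)
    have aff: "Re ((y - x) * cnj z) = (1 - q - s) * Re ((a - x) * cnj z) + q * Re ((b - x) * cnj z) + s * Re ((c - x) * cnj z)" for z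
      unfolding yy by (simp add: algebra_simps)
    have nonneg: "k \<ge> 0" if "k * t + (1 - k) * \<rho> \<le> \<rho>" "t < \<rho>" for k t
    proof -
      have "k * (\<rho> - t) \<ge> 0" using that(1) by (simp add: algebra_simps)
      then show ?thesis using that(2) by (simp add: zero_le_mult_iff)
    qed
    have 1: "1 - q - s \<ge> 0"
      using nonneg[OF _ u(4), of "1 - q - s"] le[OF u(1)] unfolding aff u by (simp add: ring_distribs)
    have 2: "q \<ge> 0"
      using nonneg[OF _ v(4), of q] le[OF v(1)] unfolding aff v by (simp add: ring_distribs)
    have 3: "s \<ge> 0"
      using nonneg[OF _ w(4), of s] le[OF w(1)] unfolding aff w by (simp add: ring_distribs)
    show ?thesis unfolding convex_hull_3 mem_Collect_eq
      by (intro exI[of _ "1 - q - s"] exI[of _ q] exI[of _ s]) (use 1 2 3 yy y in \<open>auto simp: cvec_arith\<close>)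
  qed
  moreover have "\<exists>P. tangent_to_circle_at L (cvec x) \<rho> P" if L: "L \<in> side_lines {cvec a, cvec b, cvec c}" for L
  proof -
    have "L \<in> {affine hull {cvec a, cvec b}, affine hull {cvec a, cvec c}, affine hull {cvec b, cvec c}}"
      using L unfolding side_lines_def by (auto simp: insert_commute)
    then show ?thesis
      using tangent_sideI[OF ne(1) w(1) \<rho> w(2,3)] tangent_sideI[OF ne(2) v(1) \<rho> v(2,3)]
        tangent_sideI[OF ne(3) u(1) \<rho> u(2,3)] by blast
  qed
  ultimately show ?thesis unfolding has_incircle_def by blast
qed

text \<open>Collinearity makes \<open>cnj (z2 - z1) * (z3 - z1)\<close> equal to its conjugate, and
  inverting the conjugates on the unit circle then gives \<open>z2 = z3\<close>.\<close>

lemma unit_circle_not_collinear: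
  assumes c: "cmod z1 = 1" "cmod z2 = 1" "cmod z3 = 1" and ne: "z1 \<noteq> z2" "z1 \<noteq> z3" "z2 \<noteq> z3"
  shows "Im (cnj (z2 - z1) * (z3 - z1)) \<noteq> 0"
proof
  assume "Im (cnj (z2 - z1) * (z3 - z1)) = 0"
  then have 0: "cnj (z2 - z1) * (z3 - z1) = cnj (cnj (z2 - z1) * (z3 - z1))"
    by (metis Reals_cnj_iff complex_is_Real_iff)
  have zz: "z1 * cnj z1 = 1" "z2 * cnj z2 = 1" "z3 * cnj z3 = 1" using c unit_mult_cnj by auto
  have e: "z1 * z2 * cnj (z2 - z1) = - (z2 - z1)" "z1 * z3 * cnj (z3 - z1) = - (z3 - z1)"
    using zz unfolding complex_cnj_diff by algebra+
  have "z1 * z2 * z3 * (cnj (z2 - z1) * (z3 - z1)) = z1 * z2 * z3 * (cnj (z3 - z1) * (z2 - z1))"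
    using 0 by (simp add: mult.commute)
  then have "z3 * (z2 - z1) * (z3 - z1) = z2 * (z3 - z1) * (z2 - z1)"
    using e by algebra
  then have "(z3 - z2) * ((z2 - z1) * (z3 - z1)) = 0" by algebra
  then show False using ne by simp
qed

subsection \<open>Poristic triangles as triples of roots\<close>

definition poncelet_triangle :: "real \<Rightarrow> complex \<Rightarrow> complex \<Rightarrow> complex \<Rightarrow> complex \<Rightarrow> bool" where
  "poncelet_triangle d l z1 z2 z3 \<longleftrightarrow> poncelet_root d l z1 \<and> poncelet_root d l z2 \<and> poncelet_root d l z3 \<and>
     z1 \<noteq> z2 \<and> z1 \<noteq> z3 \<and> z2 \<noteq> z3"

definition scaled_triangle :: "real \<Rightarrow> complex \<Rightarrow> complex \<Rightarrow> complex \<Rightarrow> (real^2) set" where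
  "scaled_triangle R z1 z2 z3 = {cvec (R * z1), cvec (R * z2), cvec (R * z3)}"

lemma bisector_point_scale:
  assumes "m \<noteq> 0" "bisector_point A B C X"
  shows "bisector_point (m * A + n) (m * B + n) (m * C + n) (m * X + n)"
proof -
  obtain k where k: "k > 0" and g: "X - A = k *\<^sub>R (cmod (C - A) *\<^sub>R (B - A) + cmod (B - A) *\<^sub>R (C - A))"
    using assms(2) unfolding bisector_point_def by blast
  have d: "(m * Y + n) - (m * Z + n) = m * (Y - Z)" for Y Z by (simp add: algebra_simps)
  have "m * (X - A) = (k / cmod m) *\<^sub>R (cmod (m * (C - A)) *\<^sub>R (m * (B - A)) + cmod (m * (B - A)) *\<^sub>R (m * (C - A)))"
    unfolding g norm_mult using assms(1) by (simp add: scaleR_conv_of_real field_simps)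
  moreover have "k / cmod m > 0" using k assms(1) by simp
  ultimately show ?thesis unfolding bisector_point_def d by blast
qed

lemma bisector_point_commute: "bisector_point A B C X \<longleftrightarrow> bisector_point A C B X"
  unfolding bisector_point_def by (simp add: add.commute)

text \<open>The hypothesis on \<open>r\<close> is Euler's relation between circumradius, inradius
  and the distance of the centres, with that distance measured in units of \<open>R\<close>.\<close>

lemma poristic_incenter_eq:
  assumes "R > 0" "0 \<le> d" "r = R * (1 - d\<^sup>2) / 2"
  shows "poristic_incenter R r = cvec (R * d)"
proof -
  have e: "R * (R - 2 * r) = (R * d)\<^sup>2" unfolding assms(3) by (simp add: power2_eq_square field_simps)
  have "sqrt (R * (R - 2 * r)) = R * d" unfolding e using assms(1,2) by (simp add: real_sqrt_unique)
  then show ?thesis by (simp add: poristic_incenter_def cvec_def)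
qed

lemma three_points_cvec:
  assumes "card T = 3"
  obtains a b c where "T = {cvec a, cvec b, cvec c}" "a \<noteq> b" "a \<noteq> c" "b \<noteq> c"
proof -
  obtain x y z where T: "T = {x, y, z}" "x \<noteq> y" "y \<noteq> z" "x \<noteq> z" using assms unfolding card_3_iff by blast
  obtain a where a: "x = cvec a" by (rule cvec_surj)
  obtain b where b: "y = cvec b" by (rule cvec_surj)
  obtain c where c: "z = cvec c" by (rule cvec_surj)
  show thesis using that[of a b c] T a b c by auto
qed

lemma is_triangle_cvec:
  "is_triangle {cvec a, cvec b, cvec c} \<longleftrightarrow> Im (cnj (b - a) * (c - a)) \<noteq> 0"
proof
  assume "is_triangle {cvec a, cvec b, cvec c}"
  then show "Im (cnj (b - a) * (c - a)) \<noteq> 0" using collinear_cvec unfolding is_triangle_def by blast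
next
  assume N: "Im (cnj (b - a) * (c - a)) \<noteq> 0"
  then have "a \<noteq> b" "a \<noteq> c" "b \<noteq> c" by (auto simp: algebra_simps)
  then show "is_triangle {cvec a, cvec b, cvec c}" using collinear_cvec N unfolding is_triangle_def by simp
qed

lemma poristic_bisectors:
  assumes T: "T \<in> poristic_family R r" "T = {cvec a, cvec b, cvec c}" and r: "r > 0"
    and i: "poristic_incenter R r = cvec x"
  shows "bisector_point a b c x"
  using incircle_imp_bisector_point[of a b c x r] T r i unfolding poristic_family_def by simp

text \<open>From left to right, the internal bisectors at the three vertices give the three root
  equations. From right to left, \<open>poncelet_side\<close> gives for each vertex the outward
  normal of the opposite side, with the vertex strictly inside, which is the input of
  \<open>has_incircleI\<close>.\<close>

lemma poristic_family_iff:
  assumes R: "R > 0" and d: "0 \<le> d" "d < 1" and r: "r = R * (1 - d\<^sup>2) / 2"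
  shows "T \<in> poristic_family R r \<longleftrightarrow> (\<exists>l z1 z2 z3. poncelet_triangle d l z1 z2 z3 \<and> T = scaled_triangle R z1 z2 z3)"
proof
  have "1 - d\<^sup>2 > 0" using d by (simp add: power_less_one_iff)
  then have r0: "r > 0" unfolding r using R by simp
  note inc = poristic_incenter_eq[OF R d(1) r]
  {
    assume T: "T \<in> poristic_family R r"
    then have tri: "is_triangle T" and circ: "T \<subseteq> sphere 0 R"
      by (auto simp: poristic_family_def has_circumcircle_def)
    then obtain a b c where abc: "T = {cvec a, cvec b, cvec c}" "a \<noteq> b" "a \<noteq> c" "b \<noteq> c"
      using three_points_cvec unfolding is_triangle_def by blast
    define z1 z2 z3 where "z1 = a / R" and "z2 = b / R" and "z3 = c / R"
    have z: "a = R * z1" "b = R * z2" "c = R * z3" using R by (simp_all add: z1_def z2_def z3_def)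
    have "cmod a = R" "cmod b = R" "cmod c = R" using circ unfolding abc by (simp_all add: cvec_norm)
    then have u: "cmod z1 = 1" "cmod z2 = 1" "cmod z3 = 1" using R by (simp_all add: z1_def z2_def z3_def norm_divide)
    have scale: "bisector_point (A / R) (B / R) (C / R) d" if "bisector_point A B C (R * d)" for A B C
      using bisector_point_scale[OF _ that, of "1 / R" 0] R by simp
    have b: "bisector_point z1 z2 z3 d" "bisector_point z2 z1 z3 d" "bisector_point z3 z1 z2 d"
      unfolding z1_def z2_def z3_def
      by (intro scale poristic_bisectors[OF T _ r0]; use inc abc in \<open>auto simp: insert_commute\<close>)+
    have ne: "z1 \<noteq> z2" "z1 \<noteq> z3" "z2 \<noteq> z3" using abc z by auto
    have "poncelet_triangle d (z1 * z2 * z3) z1 z2 z3"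
      using bisector_imp_poncelet_root[OF u(1) u(2) u(3) _ _ b(1)]
        bisector_imp_poncelet_root[OF u(2) u(1) u(3) _ _ b(2)]
        bisector_imp_poncelet_root[OF u(3) u(1) u(2) _ _ b(3)] ne
      by (simp add: poncelet_triangle_def mult_ac)
    then show "\<exists>l z1 z2 z3. poncelet_triangle d l z1 z2 z3 \<and> T = scaled_triangle R z1 z2 z3"
      using abc(1) z unfolding scaled_triangle_def by auto
  }
  assume "\<exists>l z1 z2 z3. poncelet_triangle d l z1 z2 z3 \<and> T = scaled_triangle R z1 z2 z3"
  then obtain l z1 z2 z3 where p: "poncelet_triangle d l z1 z2 z3" and T: "T = scaled_triangle R z1 z2 z3" by blast
  have z: "poncelet_root d l z1" "poncelet_root d l z2" "poncelet_root d l z3"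
    and ne: "z1 \<noteq> z2" "z1 \<noteq> z3" "z2 \<noteq> z3" using p by (auto simp: poncelet_triangle_def)
  have u: "cmod z1 = 1" "cmod z2 = 1" "cmod z3 = 1" using z by (auto simp: poncelet_root_def)
  have N: "Im (cnj (R * z2 - R * z1) * (R * z3 - R * z1)) \<noteq> 0"
  proof -
    have "cnj (R * z2 - R * z1) * (R * z3 - R * z1) = complex_of_real (R * R) * (cnj (z2 - z1) * (z3 - z1))"
      by (simp add: algebra_simps)
    then have "Im (cnj (R * z2 - R * z1) * (R * z3 - R * z1)) = R * R * Im (cnj (z2 - z1) * (z3 - z1))"
      by (simp only: Im_complex_of_real Re_complex_of_real times_complex.sel; simp)
    then show ?thesis using unit_circle_not_collinear[OF u ne] R by simp
  qed
  have sc: "Re ((R * z - complex_of_real (R * d)) * cnj u) = R * (Re (z * cnj u) - d * Re u)" for z u :: complex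
    by (simp add: algebra_simps)
  \<comment> \<open>With \<open>x = Re u\<close>, the line at offset
    \<open>d * x + (1 - d^2) / 2\<close> from the circumcentre has offset
    \<open>(1 - d^2) / 2\<close> from the incentre; the factor \<open>R\<close> turns this into the
    inradius.\<close>
  have rr: "r = R * ((d * x + (1 - d\<^sup>2) / 2) - d * x)" for x by (simp add: r)
  have side: "\<exists>u. cmod u = 1 \<and> Re ((R * b - complex_of_real (R * d)) * cnj u) = r \<and>
     Re ((R * c - complex_of_real (R * d)) * cnj u) = r \<and> Re ((R * a - complex_of_real (R * d)) * cnj u) < r"
    if abc: "poncelet_root d l a" "poncelet_root d l b" "poncelet_root d l c" "b \<noteq> c" "b \<noteq> a" "c \<noteq> a" for a b c :: complex
  proof -
    obtain u where u: "cmod u = 1" "Re (b * cnj u) = d * Re u + (1 - d\<^sup>2) / 2"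
      "Re (c * cnj u) = d * Re u + (1 - d\<^sup>2) / 2" "Re (a * cnj u) < d * Re u + (1 - d\<^sup>2) / 2"
      using poncelet_side[OF abc(2,3,1) abc(4-6) d] by blast
    have "R * (Re (b * cnj u) - d * Re u) = r" "R * (Re (c * cnj u) - d * Re u) = r"
      unfolding u(2,3) by (rule rr[symmetric])+
    moreover have "R * (Re (a * cnj u) - d * Re u) < R * ((d * Re u + (1 - d\<^sup>2) / 2) - d * Re u)"
      using u(4) R by (intro mult_strict_left_mono) linarith+
    ultimately show ?thesis unfolding sc rr[of "Re u", symmetric] using u(1) by blast
  qed
  obtain v1 v2 v3 where v:
    "cmod v1 = 1" "Re ((R * z2 - complex_of_real (R * d)) * cnj v1) = r" "Re ((R * z3 - complex_of_real (R * d)) * cnj v1) = r" "Re ((R * z1 - complex_of_real (R * d)) * cnj v1) < r"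
    "cmod v2 = 1" "Re ((R * z1 - complex_of_real (R * d)) * cnj v2) = r" "Re ((R * z3 - complex_of_real (R * d)) * cnj v2) = r" "Re ((R * z2 - complex_of_real (R * d)) * cnj v2) < r"
    "cmod v3 = 1" "Re ((R * z1 - complex_of_real (R * d)) * cnj v3) = r" "Re ((R * z2 - complex_of_real (R * d)) * cnj v3) = r" "Re ((R * z3 - complex_of_real (R * d)) * cnj v3) < r"
    using side[OF z(1) z(2) z(3)] side[OF z(2) z(1) z(3)] side[OF z(3) z(1) z(2)] ne by metis
  have "has_incircle T (cvec (R * d)) r"
    unfolding T scaled_triangle_def by (rule has_incircleI[OF N r0 v])
  moreover have "is_triangle T" unfolding T scaled_triangle_def is_triangle_cvec by (rule N)
  moreover have "has_circumcircle T 0 R"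
    using u R unfolding T scaled_triangle_def has_circumcircle_def by (simp add: cvec_norm norm_mult)
  ultimately show "T \<in> poristic_family R r" unfolding poristic_family_def inc by blast
qed

section \<open>Parametrisation by the contact point\<close>

definition touches_at :: "real \<Rightarrow> real \<Rightarrow> (real^2) set \<Rightarrow> real \<Rightarrow> bool" where
  "touches_at R r T t \<longleftrightarrow> T \<in> poristic_family R r \<and>
        (\<exists>L\<in>side_lines T. tangent_to_circle_at L (poristic_incenter R r) r
           (poristic_incenter R r + r *\<^sub>R vector [cos t, sin t]))"

lemma cvec_cis: "vector [cos t, sin t] = cvec (cis t)"
  by (simp add: cvec_def)

lemma poncelet_triangle_permute:
  assumes "poncelet_triangle d l z1 z2 z3" "{w1, w2, w3} = {z1, z2, z3}" "w1 \<noteq> w2" "w1 \<noteq> w3" "w2 \<noteq> w3"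
  shows "poncelet_triangle d l w1 w2 w3"
proof -
  have "w1 \<in> {z1, z2, z3}" "w2 \<in> {z1, z2, z3}" "w3 \<in> {z1, z2, z3}" using assms(2) by blast+
  then show ?thesis using assms by (auto simp: poncelet_triangle_def)
qed

text \<open>A triangle is an unordered set, so the touching side may join any two vertices; a
  permutation makes them the first two.\<close>

lemma touches_at_iff:
  assumes R: "R > 0" and d: "0 \<le> d" "d < 1" and r: "r = R * (1 - d\<^sup>2) / 2"
  shows "touches_at R r T t \<longleftrightarrow> (\<exists>l z1 z2 z3. poncelet_triangle d l z1 z2 z3 \<and> T = scaled_triangle R z1 z2 z3 \<and>
     Re (z1 * cnj (cis t)) = d * cos t + (1 - d\<^sup>2) / 2 \<and> Re (z2 * cnj (cis t)) = d * cos t + (1 - d\<^sup>2) / 2)"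
proof
  have "1 - d\<^sup>2 > 0" using d by (simp add: power_less_one_iff)
  then have r0: "r > 0" unfolding r using R by simp
  note inc = poristic_incenter_eq[OF R d(1) r]
  have pt: "poristic_incenter R r + r *\<^sub>R vector [cos t, sin t] = cvec (R * d + r * cis t)"
    unfolding inc cvec_cis cvec_arith by (simp add: scaleR_conv_of_real)
  have sc: "Re ((R * z - complex_of_real (R * d)) * cnj (cis t)) = R * (Re (z * cnj (cis t)) - d * cos t)" for z :: complex
    by (simp add: algebra_simps)
  have h: "Re ((R * z - complex_of_real (R * d)) * cnj (cis t)) = r \<longleftrightarrow>
      Re (z * cnj (cis t)) = d * cos t + (1 - d\<^sup>2) / 2" for z :: complex
  proof -
    have "R * (Re (z * cnj (cis t)) - d * cos t) = r \<longleftrightarrow> R * (Re (z * cnj (cis t)) - d * cos t) = R * ((1 - d\<^sup>2) / 2)"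
      by (simp add: r)
    also have "\<dots> \<longleftrightarrow> Re (z * cnj (cis t)) - d * cos t = (1 - d\<^sup>2) / 2"
      using mult_left_cancel[of R "Re (z * cnj (cis t)) - d * cos t" "(1 - d\<^sup>2) / 2"] R by linarith
    finally show ?thesis unfolding sc by linarith
  qed
  {
    assume "touches_at R r T t"
    then obtain L where T: "T \<in> poristic_family R r" and L: "L \<in> side_lines T"
      and tan: "tangent_to_circle_at L (cvec (R * d)) r (cvec (R * d + r * cis t))"
      unfolding touches_at_def pt unfolding inc by blast
    obtain l z1 z2 z3 where p: "poncelet_triangle d l z1 z2 z3" and Teq: "T = scaled_triangle R z1 z2 z3"
      using T unfolding poristic_family_iff[OF R d r] by blast
    obtain A B where AB: "A \<in> T" "B \<in> T" "A \<noteq> B" "L = affine hull {A, B}"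
      using L unfolding side_lines_def by blast
    have "T = (\<lambda>z. cvec (R * z)) ` {z1, z2, z3}" by (simp add: Teq scaled_triangle_def)
    then obtain w1 w2 :: complex where w: "w1 \<in> {z1, z2, z3}" "w2 \<in> {z1, z2, z3}" "A = cvec (R * w1)" "B = cvec (R * w2)"
      using AB by blast
    then have ne: "w1 \<noteq> w2" using AB by auto
    have ne': "R * w1 \<noteq> R * w2" using AB w by auto
    have dist: "z1 \<noteq> z2" "z1 \<noteq> z3" "z2 \<noteq> z3" using p by (auto simp: poncelet_triangle_def)
    have "\<exists>w3. w1 \<noteq> w3 \<and> w2 \<noteq> w3 \<and> {w1, w2, w3} = {z1, z2, z3}"
      using w(1,2) ne dist by auto
    then obtain w3 where w3: "w1 \<noteq> w3" "w2 \<noteq> w3" "{w1, w2, w3} = {z1, z2, z3}" by blast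
    have p': "poncelet_triangle d l w1 w2 w3"
      using poncelet_triangle_permute[OF p w3(3) ne w3(1,2)] .
    have T': "T = scaled_triangle R w1 w2 w3"
      using arg_cong[OF w3(3), of "\<lambda>S. (\<lambda>z. cvec (R * z)) ` S"] unfolding Teq scaled_triangle_def by simp
    obtain u where "cmod u = 1" and
      u: "complex_of_real (R * d) + complex_of_real r * cis t = complex_of_real (R * d) + complex_of_real r * u"
      "Re ((R * w1 - complex_of_real (R * d)) * cnj u) = r" "Re ((R * w2 - complex_of_real (R * d)) * cnj u) = r"
      by (rule tangent_side_imp[OF tan[unfolded AB(4) w(3,4)] ne' r0])
    have cis: "u = cis t" using u(1) r0 by simp
    have "Re ((R * w1 - complex_of_real (R * d)) * cnj (cis t)) = r" "Re ((R * w2 - complex_of_real (R * d)) * cnj (cis t)) = r"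
      using u(2,3) unfolding cis by blast+
    then have "Re (w1 * cnj (cis t)) = d * cos t + (1 - d\<^sup>2) / 2" "Re (w2 * cnj (cis t)) = d * cos t + (1 - d\<^sup>2) / 2"
      unfolding h by blast+
    then show "\<exists>l z1 z2 z3. poncelet_triangle d l z1 z2 z3 \<and> T = scaled_triangle R z1 z2 z3 \<and>
     Re (z1 * cnj (cis t)) = d * cos t + (1 - d\<^sup>2) / 2 \<and> Re (z2 * cnj (cis t)) = d * cos t + (1 - d\<^sup>2) / 2"
      using p' T' by blast
  }
  assume "\<exists>l z1 z2 z3. poncelet_triangle d l z1 z2 z3 \<and> T = scaled_triangle R z1 z2 z3 \<and>
     Re (z1 * cnj (cis t)) = d * cos t + (1 - d\<^sup>2) / 2 \<and> Re (z2 * cnj (cis t)) = d * cos t + (1 - d\<^sup>2) / 2"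
  then obtain l z1 z2 z3 where p: "poncelet_triangle d l z1 z2 z3" and T: "T = scaled_triangle R z1 z2 z3"
    and z: "Re (z1 * cnj (cis t)) = d * cos t + (1 - d\<^sup>2) / 2" "Re (z2 * cnj (cis t)) = d * cos t + (1 - d\<^sup>2) / 2"
    by blast
  have "T \<in> poristic_family R r" unfolding poristic_family_iff[OF R d r] using p T by blast
  moreover have ne: "R * z1 \<noteq> R * z2" using p R by (simp add: poncelet_triangle_def)
  then have "affine hull {cvec (R * z1), cvec (R * z2)} \<in> side_lines T"
    unfolding T scaled_triangle_def side_lines_def by fastforce
  moreover have "tangent_to_circle_at (affine hull {cvec (R * z1), cvec (R * z2)}) (cvec (R * d)) r (cvec (R * d + r * cis t))"
    using tangent_sideI[OF ne _ r0, of "cis t" "complex_of_real (R * d)"] h[of z1] h[of z2] z by simp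
  ultimately show "touches_at R r T t" unfolding touches_at_def pt unfolding inc by blast
qed

text \<open>\<open>touches_at\<close> is the predicate under the definite description in
  \<open>poristic_triangle\<close>, which says nothing before unique existence is known. Existence
  is the explicit construction from a tangent direction, and uniqueness is
  \<open>poncelet_triangle_unique\<close>.\<close>

lemma touches_at_iff_poristic_triangle:
  assumes R: "R > 0" and d: "0 \<le> d" "d < 1" and r: "r = R * (1 - d\<^sup>2) / 2"
  shows "touches_at R r T t \<longleftrightarrow> T = poristic_triangle R r t"
proof -
  have "\<exists>!T. touches_at R r T t"
  proof (rule ex_ex1I)
    show "\<exists>T. touches_at R r T t"
    proof -
      obtain l z1 z2 z3 where "poncelet_root d l z1" "poncelet_root d l z2" "poncelet_root d l z3"
        "z1 \<noteq> z2" "z1 \<noteq> z3" "z2 \<noteq> z3"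
        "Re (z1 * cnj (cis t)) = d * Re (cis t) + (1 - d\<^sup>2) / 2" "Re (z2 * cnj (cis t)) = d * Re (cis t) + (1 - d\<^sup>2) / 2"
        by (rule poncelet_triangle_exists[OF norm_cis d])
      then have "touches_at R r (scaled_triangle R z1 z2 z3) t"
        unfolding touches_at_iff[OF assms] poncelet_triangle_def cis.sel(1) by blast
      then show ?thesis ..
    qed
    fix T T'
    assume "touches_at R r T t" "touches_at R r T' t"
    then obtain l z1 z2 z3 m w1 w2 w3 where
      z: "poncelet_triangle d l z1 z2 z3" "T = scaled_triangle R z1 z2 z3"
      "Re (z1 * cnj (cis t)) = d * cos t + (1 - d\<^sup>2) / 2" "Re (z2 * cnj (cis t)) = d * cos t + (1 - d\<^sup>2) / 2"
      and w: "poncelet_triangle d m w1 w2 w3" "T' = scaled_triangle R w1 w2 w3"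
      "Re (w1 * cnj (cis t)) = d * cos t + (1 - d\<^sup>2) / 2" "Re (w2 * cnj (cis t)) = d * cos t + (1 - d\<^sup>2) / 2"
      unfolding touches_at_iff[OF assms] by blast
    have "{z1, z2, z3} = {w1, w2, w3}"
      by (rule poncelet_triangle_unique[where l = l and m = m, OF _ _ _ _ _ _ _ _ _ _ _ _ d norm_cis z(3,4) w(3,4)])
        (use z(1) w(1) in \<open>simp_all add: poncelet_triangle_def\<close>)
    from arg_cong[OF this, of "\<lambda>S. (\<lambda>z. cvec (R * z)) ` S"] show "T = T'"
      unfolding z(2) w(2) scaled_triangle_def by simp
  qed
  moreover have "poristic_triangle R r t = (THE T. touches_at R r T t)"
    unfolding poristic_triangle_def touches_at_def ..
  ultimately show ?thesis by (metis the_equality)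
qed

lemma poristic_triangle_in_family:
  assumes R: "R > 0" and d: "0 \<le> d" "d < 1" and r: "r = R * (1 - d\<^sup>2) / 2"
  shows "\<exists>l z1 z2 z3. poncelet_triangle d l z1 z2 z3 \<and> poristic_triangle R r t = scaled_triangle R z1 z2 z3"
proof -
  have "touches_at R r (poristic_triangle R r t) t" unfolding touches_at_iff_poristic_triangle[OF assms] ..
  then show ?thesis unfolding touches_at_iff[OF assms] by blast
qed

text \<open>The parameter is the argument of the outward normal of the side joining
  \<open>z1\<close> and \<open>z2\<close>. It is taken in one period starting at 0, so that its
  number of full turns is zero.\<close>

lemma poristic_triangle_surj:
  assumes R: "R > 0" and d: "0 \<le> d" "d < 1" and r: "r = R * (1 - d\<^sup>2) / 2"
    and p: "poncelet_triangle d l z1 z2 z3"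
  obtains t where "0 \<le> t" "t < 2 * pi" "poristic_triangle R r t = scaled_triangle R z1 z2 z3"
proof -
  obtain u where u: "cmod u = 1" "Re (z1 * cnj u) = d * Re u + (1 - d\<^sup>2) / 2"
    "Re (z2 * cnj u) = d * Re u + (1 - d\<^sup>2) / 2"
    by (rule poncelet_side[of d l z1 z2 z3, OF _ _ _ _ _ _ d]) (use p in \<open>simp_all add: poncelet_triangle_def\<close>)
  define t where "t = Arg2pi u"
  have "u = cis t" using u(1) Arg2pi_eq[of u] by (simp add: t_def cis_conv_exp)
  then have "touches_at R r (scaled_triangle R z1 z2 z3) t"
    using p u unfolding touches_at_iff[OF assms(1-4)] by auto
  then have "poristic_triangle R r t = scaled_triangle R z1 z2 z3" using touches_at_iff_poristic_triangle[OF assms(1-4)] by simp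
  then show thesis
    using that[of t] Arg2pi_ge_0[of u] Arg2pi_lt_2pi[of u] unfolding t_def by blast
qed

lemma poristic_triangle_periodic: "poristic_triangle R r (t + 2 * pi) = poristic_triangle R r t"
  unfolding poristic_triangle_def by simp

subsection \<open>Ellipses, normals and bisectors\<close>

text \<open>The coefficients are the inverse squares of the semi-axes; the normal direction at (x,
  y) is then (p x, q y), without square roots.\<close>

definition axis_ellipse :: "real \<Rightarrow> real \<Rightarrow> (real^2) set" where
  "axis_ellipse p q = {X. p * (X $ 1)\<^sup>2 + q * (X $ 2)\<^sup>2 = 1}"

lemma is_ellipse_axis_ellipse:
  assumes "p > 0" "q > 0"
  shows "is_ellipse (axis_ellipse p q)"
proof -
  have "(x / (1 / sqrt k))\<^sup>2 = k * x\<^sup>2" if "k > 0" for x k :: real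
    using that by (simp add: power_mult_distrib)
  then have "axis_ellipse p q = {X. (((X - 0) \<bullet> cvec 1) / (1 / sqrt p))\<^sup>2 + (((X - 0) \<bullet> cvec \<i>) / (1 / sqrt q))\<^sup>2 = 1}"
    using assms unfolding axis_ellipse_def by (simp add: inner_vec_def sum_2)
  moreover have "norm (cvec 1) = 1" "norm (cvec \<i>) = 1" "cvec 1 \<bullet> cvec \<i> = 0"
    by (simp_all add: cvec_norm cvec_inner)
  moreover have "1 / sqrt p > 0" "1 / sqrt q > 0" using assms by simp_all
  ultimately show ?thesis unfolding is_ellipse_def by blast
qed

text \<open>One direction differentiates the equation along the curve. For the other, a pair of
  conjugate semi-diameters yields a trigonometric curve on the ellipse with the required
  velocity.\<close>

lemma tangent_vector_axis_ellipse:
  assumes pq: "p > 0" "q > 0" and P: "P \<in> axis_ellipse p q"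
  shows "tangent_vector (axis_ellipse p q) P w \<longleftrightarrow> p * P $ 1 * w $ 1 + q * P $ 2 * w $ 2 = 0"
proof
  assume "tangent_vector (axis_ellipse p q) P w"
  then obtain \<gamma> :: "real \<Rightarrow> real^2" where g0: "\<gamma> 0 = P" and ev: "\<forall>\<^sub>F s in nhds 0. \<gamma> s \<in> axis_ellipse p q"
    and der: "(\<gamma> has_vector_derivative w) (at 0)" unfolding tangent_vector_def by blast
  have comp: "((\<lambda>s. \<gamma> s $ i) has_real_derivative w $ i) (at 0)" for i
    unfolding has_real_derivative_iff_has_vector_derivative
    using bounded_linear.has_vector_derivative[OF bounded_linear_vec_nth der] .
  have "((\<lambda>s. p * (\<gamma> s $ 1)\<^sup>2 + q * (\<gamma> s $ 2)\<^sup>2) has_real_derivative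
      (p * (2 * \<gamma> 0 $ 1 * w $ 1) + q * (2 * \<gamma> 0 $ 2 * w $ 2))) (at 0)"
    by (auto intro!: derivative_eq_intros comp)
  moreover have "\<forall>\<^sub>F s in nhds 0. p * (\<gamma> s $ 1)\<^sup>2 + q * (\<gamma> s $ 2)\<^sup>2 = 1"
    using ev by (simp add: axis_ellipse_def)
  ultimately have "((\<lambda>s. 1) has_real_derivative (p * (2 * \<gamma> 0 $ 1 * w $ 1) + q * (2 * \<gamma> 0 $ 2 * w $ 2))) (at (0::real))"
    by (subst (asm) DERIV_cong_ev[OF refl _ refl]) auto
  then have "p * (2 * \<gamma> 0 $ 1 * w $ 1) + q * (2 * \<gamma> 0 $ 2 * w $ 2) = 0"
    using DERIV_unique DERIV_const by blast
  then show "p * P $ 1 * w $ 1 + q * P $ 2 * w $ 2 = 0" unfolding g0 by simp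
next
  assume o: "p * P $ 1 * w $ 1 + q * P $ 2 * w $ 2 = 0"
  define x y where "x = P $ 1" and "y = P $ 2"
  have E: "p * x\<^sup>2 + q * y\<^sup>2 = 1" using P by (simp add: axis_ellipse_def x_def y_def)
  \<comment> \<open>This makes (- q m y, p m x) a point of the ellipse, the end of the semi-diameter
    conjugate to that of \<open>P\<close>; \<open>w\<close> is \<open>k\<close> times this
    vector.\<close>
  define m where "m = 1 / sqrt (p * q)"
  have m: "p * q * m\<^sup>2 = 1" using pq by (simp add: m_def power_divide)
  have m0: "m \<noteq> 0" using m by auto
  define D where "D = (q * y)\<^sup>2 + (p * x)\<^sup>2"
  have "x \<noteq> 0 \<or> y \<noteq> 0" using E by auto
  then have D: "D > 0" using pq by (auto simp: D_def sum_power2_gt_zero_iff)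
  define k where "k = (p * x * w $ 2 - q * y * w $ 1) / (D * m)"
  have w: "w $ 1 = - k * m * q * y" "w $ 2 = k * m * p * x"
  proof -
    have km: "k * m = (p * x * w $ 2 - q * y * w $ 1) / D" using m0 by (simp add: k_def)
    have o': "p * x * w $ 1 + q * y * w $ 2 = 0" using o by (simp add: x_def y_def)
    have e: "D * w $ 1 = - (p * x * w $ 2 - q * y * w $ 1) * q * y"
      "D * w $ 2 = (p * x * w $ 2 - q * y * w $ 1) * p * x" unfolding D_def using o' by algebra+
    have "w $ 1 = D * w $ 1 / D" using D by simp
    also have "\<dots> = - (k * m) * q * y" unfolding e km by (simp add: algebra_simps diff_divide_distrib)
    finally show "w $ 1 = - k * m * q * y" by simp
    have "w $ 2 = D * w $ 2 / D" using D by simp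
    also have "\<dots> = (k * m) * p * x" unfolding e km by simp
    finally show "w $ 2 = k * m * p * x" .
  qed
  define \<gamma> :: "real \<Rightarrow> real^2" where
    "\<gamma> s = (x * cos (k * s) - q * m * y * sin (k * s)) *\<^sub>R axis 1 1 + (y * cos (k * s) + p * m * x * sin (k * s)) *\<^sub>R axis 2 1" for s
  have nth: "\<gamma> s $ 1 = x * cos (k * s) - q * m * y * sin (k * s)" "\<gamma> s $ 2 = y * cos (k * s) + p * m * x * sin (k * s)" for s
    by (simp_all add: \<gamma>_def axis_def)
  have "\<gamma> 0 = P" by (simp add: vec_eq_iff forall_2 nth x_def y_def)
  moreover have "\<gamma> s \<in> axis_ellipse p q" for s
  proof -
    have "p * (\<gamma> s $ 1)\<^sup>2 + q * (\<gamma> s $ 2)\<^sup>2 =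
       (p * x\<^sup>2 + q * y\<^sup>2) * ((cos (k * s))\<^sup>2 + (p * q * m\<^sup>2) * (sin (k * s))\<^sup>2)"
      unfolding nth by algebra
    also have "\<dots> = 1" unfolding E m by simp
    finally show ?thesis by (simp add: axis_ellipse_def)
  qed
  moreover have "(\<gamma> has_vector_derivative w) (at 0)"
  proof -
    have "(\<gamma> has_vector_derivative ((- q * m * y * k) *\<^sub>R axis 1 1 + (p * m * x * k) *\<^sub>R axis 2 1)) (at 0)"
      unfolding \<gamma>_def[abs_def]
      by (auto intro!: derivative_eq_intros has_vector_derivative_add has_vector_derivative_scaleR
          simp: has_real_derivative_iff_has_vector_derivative[symmetric] mult_ac)
    moreover have "(- q * m * y * k) *\<^sub>R axis 1 1 + (p * m * x * k) *\<^sub>R axis 2 1 = w"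
      unfolding vec_eq_iff forall_2 w by (simp add: axis_def)
    ultimately show ?thesis by simp
  qed
  ultimately show "tangent_vector (axis_ellipse p q) P w" unfolding tangent_vector_def by auto
qed

lemma normal_line_axis_ellipse:
  assumes pq: "p > 0" "q > 0" and P: "P \<in> axis_ellipse p q"
  shows "X \<in> normal_line (axis_ellipse p q) P \<longleftrightarrow> (X $ 2 - P $ 2) * (p * P $ 1) = (X $ 1 - P $ 1) * (q * P $ 2)"
proof
  assume X: "X \<in> normal_line (axis_ellipse p q) P"
  have "tangent_vector (axis_ellipse p q) P (vector [- q * P $ 2, p * P $ 1])"
    unfolding tangent_vector_axis_ellipse[OF assms] by simp
  then have "(X - P) \<bullet> vector [- q * P $ 2, p * P $ 1] = 0" using X unfolding normal_line_def by blast
  then show "(X $ 2 - P $ 2) * (p * P $ 1) = (X $ 1 - P $ 1) * (q * P $ 2)"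
    by (simp add: inner_vec_def sum_2 algebra_simps)
next
  assume X: "(X $ 2 - P $ 2) * (p * P $ 1) = (X $ 1 - P $ 1) * (q * P $ 2)"
  have "(X - P) \<bullet> w = 0" if "tangent_vector (axis_ellipse p q) P w" for w
  proof -
    have w: "p * P $ 1 * w $ 1 + q * P $ 2 * w $ 2 = 0"
      using that unfolding tangent_vector_axis_ellipse[OF assms] .
    have "((X - P) \<bullet> w) * (p * P $ 1) = 0" "((X - P) \<bullet> w) * (q * P $ 2) = 0"
      using X w unfolding inner_vec_def sum_2 inner_real_def vector_minus_component by algebra+
    moreover have "p * P $ 1 \<noteq> 0 \<or> q * P $ 2 \<noteq> 0" using P pq by (auto simp: axis_ellipse_def)
    ultimately show ?thesis by auto
  qed
  then show "X \<in> normal_line (axis_ellipse p q) P" by (simp add: normal_line_def)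
qed

section \<open>Half angles and internal bisectors\<close>

lemma angle_at_cvec:
  "angle_at (cvec p) (cvec a) (cvec b) = arccos (Re ((a - p) * cnj (b - p)) / (cmod (a - p) * cmod (b - p)))"
  unfolding angle_at_def cvec_arith cvec_inner cvec_norm ..

lemma cosine_bounds:
  assumes "e \<noteq> 0" "f \<noteq> 0"
  shows "-1 \<le> Re (e * cnj f) / (cmod e * cmod f)" "Re (e * cnj f) / (cmod e * cmod f) \<le> 1"
proof -
  have "\<bar>Re (e * cnj f)\<bar> \<le> cmod e * cmod f"
    using abs_Re_le_cmod[of "e * cnj f"] by (simp only: norm_mult complex_mod_cnj)
  then show "-1 \<le> Re (e * cnj f) / (cmod e * cmod f)" "Re (e * cnj f) / (cmod e * cmod f) \<le> 1"
    using assms by (simp_all add: field_simps abs_le_iff del: times_complex.sel)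
qed

text \<open>Half of the angle lies strictly between 0 and pi/2, so it is determined by its cosine,
  which is positive. The two cosine conditions are linear in the coordinates of \<open>g\<close>
  with respect to \<open>e\<close> and \<open>f\<close> and force the direction of the rhombus
  diagonal; the sign of the cosine selects the ray.\<close>

lemma half_angles_iff:
  assumes N: "Im (cnj e * f) \<noteq> 0" and g: "g \<noteq> 0"
  defines "ang \<equiv> \<lambda>e f. arccos (Re (e * cnj f) / (cmod e * cmod f))"
  shows "ang e g = ang e f / 2 \<and> ang g f = ang e f / 2 \<longleftrightarrow> (\<exists>k>0. g = k *\<^sub>R (cmod f *\<^sub>R e + cmod e *\<^sub>R f))"
proof -
  have ef: "cmod e > 0" "cmod f > 0" using N by auto
  have ne: "e \<noteq> 0" "f \<noteq> 0" using ef by auto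
  define m n s where "m = cmod e" and "n = cmod f" and "s = Re (e * cnj f)"
  have mn: "m > 0" "n > 0" using ef by (simp_all add: m_def n_def)
  have "\<bar>Re (cnj e * f)\<bar> < cmod (cnj e * f)" using abs_Re_less_cmod[OF N] .
  then have "\<bar>s\<bar> < m * n" unfolding norm_mult complex_mod_cnj by (simp add: s_def m_def n_def)
  then have s: "- (m * n) < s" "s < m * n" by auto
  have ee: "Re (e * cnj e) = m\<^sup>2" "Re (f * cnj f) = n\<^sup>2"
    unfolding m_def n_def complex_norm_square[symmetric] by simp_all
  have fe: "Re (f * cnj e) = s" by (simp add: s_def mult.commute)
  define x where "x = ang e f / 2"
  have c: "-1 < s / (m * n)" "s / (m * n) < 1" using s mn by (simp_all add: field_simps)
  have x2: "2 * x = arccos (s / (m * n))" by (simp add: x_def ang_def s_def m_def n_def)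
  have cx: "cos (2 * x) = s / (m * n)" unfolding x2 using c by simp
  have x: "0 < x" "x < pi / 2" using arccos_lt_bounded[OF c] x2 by linarith+
  have cpos: "cos x > 0" using x by (simp add: cos_gt_zero_pi)
  have c2: "2 * (cos x)\<^sup>2 = (m * n + s) / (m * n)"
  proof -
    have "(m * n + s) / (m * n) = 1 + s / (m * n)" using mn by (simp add: add_divide_distrib)
    then show ?thesis using cx unfolding cos_double_cos by linarith
  qed
  have acx: "arccos (cos x) = x" using x by (simp add: arccos_cos)
  define cg where "cg = cmod g"
  have cg: "cg > 0" using g by (simp add: cg_def)
  have 1: "ang e g = x \<longleftrightarrow> Re (e * cnj g) = m * cg * cos x"
  proof
    assume "ang e g = x"
    then have "cos x = Re (e * cnj g) / (cmod e * cmod g)"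
      unfolding ang_def using cos_arccos cosine_bounds[OF ne(1) g] by blast
    then show "Re (e * cnj g) = m * cg * cos x" using mn cg by (simp add: m_def cg_def del: times_complex.sel)
  next
    assume "Re (e * cnj g) = m * cg * cos x"
    then have "Re (e * cnj g) / (cmod e * cmod g) = cos x" using mn cg by (simp add: m_def cg_def del: times_complex.sel)
    then show "ang e g = x" using acx unfolding ang_def by simp
  qed
  have 2: "ang g f = x \<longleftrightarrow> Re (f * cnj g) = n * cg * cos x"
  proof
    assume "ang g f = x"
    then have "cos x = Re (g * cnj f) / (cmod g * cmod f)"
      unfolding ang_def using cos_arccos cosine_bounds[OF g ne(2)] by blast
    then have "Re (g * cnj f) = n * cg * cos x" using mn cg by (simp add: n_def cg_def del: times_complex.sel)
    then show "Re (f * cnj g) = n * cg * cos x" by (simp add: mult.commute)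
  next
    assume "Re (f * cnj g) = n * cg * cos x"
    then have "Re (g * cnj f) = n * cg * cos x" by (simp add: mult.commute)
    then have "Re (g * cnj f) / (cmod g * cmod f) = cos x" using mn cg by (simp add: n_def cg_def del: times_complex.sel)
    then show "ang g f = x" using acx unfolding ang_def by simp
  qed
  have 3: "Re (e * cnj g) = m * cg * cos x \<and> Re (f * cnj g) = n * cg * cos x \<longleftrightarrow> (\<exists>k>0. g = k *\<^sub>R (n *\<^sub>R e + m *\<^sub>R f))"
  proof
    assume h: "Re (e * cnj g) = m * cg * cos x \<and> Re (f * cnj g) = n * cg * cos x"
    obtain a b where ab: "g = a *\<^sub>R e + b *\<^sub>R f" using plane_coordinates[OF N] by blast
    have eg: "Re (e * cnj g) = a * m\<^sup>2 + b * s"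
      unfolding ee(1)[symmetric] s_def ab by (simp add: algebra_simps)
    have fg: "Re (f * cnj g) = a * s + b * n\<^sup>2"
      unfolding ee(2)[symmetric] fe[symmetric] ab by (simp add: algebra_simps)
    have "n * Re (e * cnj g) = m * Re (f * cnj g)" using h by (simp del: times_complex.sel)
    \<comment> \<open>The first factor is nonzero because the sides are not parallel.\<close>
    then have "(m * n - s) * (a * m - b * n) = 0" unfolding eg fg by algebra
    then have am: "a * m = b * n" using s by simp
    define k where "k = a / n"
    have a: "a = k * n" using mn by (simp add: k_def)
    have b: "b = k * m" using am mn unfolding a by simp
    have "k * (m * (m * n + s)) = Re (e * cnj g)" unfolding eg a b by algebra
    also have "\<dots> > 0" using h mn cg cpos by simp
    finally have "k * (m * (m * n + s)) > 0" .
    moreover have "m * (m * n + s) > 0" using mn s by (intro mult_pos_pos) linarith+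
    ultimately have "k > 0" by (rule zero_less_mult_pos2)
    moreover have "g = k *\<^sub>R (n *\<^sub>R e + m *\<^sub>R f)" unfolding ab a b by (simp add: scaleR_add_right)
    ultimately show "\<exists>k>0. g = k *\<^sub>R (n *\<^sub>R e + m *\<^sub>R f)" by blast
  next
    assume "\<exists>k>0. g = k *\<^sub>R (n *\<^sub>R e + m *\<^sub>R f)"
    then obtain k where k: "k > 0" and gk: "g = k *\<^sub>R (n *\<^sub>R e + m *\<^sub>R f)" by blast
    have eg: "Re (e * cnj g) = k * (m * (m * n + s))"
    proof -
      have "Re (e * cnj g) = k * (n * Re (e * cnj e) + m * Re (e * cnj f))" unfolding gk by (simp add: algebra_simps)
      then show ?thesis unfolding ee s_def[symmetric] by algebra
    qed
    have fg: "Re (f * cnj g) = k * (n * (m * n + s))"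
    proof -
      have "Re (f * cnj g) = k * (n * Re (f * cnj e) + m * Re (f * cnj f))" unfolding gk by (simp add: algebra_simps)
      then show ?thesis unfolding ee fe by algebra
    qed
    \<comment> \<open>The length of \<open>g\<close> is matched through
      \<open>2 * (cos x)^2 = 1 + cos (2 * x)\<close>; both sides are nonnegative, so comparing
      squares suffices.\<close>
    have "cg\<^sup>2 = Re (g * cnj g)" unfolding cg_def complex_norm_square[symmetric] by simp
    also have "\<dots> = k * (n * Re (e * cnj g) + m * Re (f * cnj g))"
      by (subst (1) gk) (simp add: algebra_simps)
    finally have cg2: "cg\<^sup>2 = k\<^sup>2 * (2 * (m * n) * (m * n + s))" unfolding eg fg by algebra
    have "(cg * cos x)\<^sup>2 * 2 = cg\<^sup>2 * (2 * (cos x)\<^sup>2)" by (simp add: power_mult_distrib)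
    also have "\<dots> = (k * (m * n + s))\<^sup>2 * 2" unfolding cg2 c2 using mn by (simp add: field_simps power2_eq_square)
    finally have "(cg * cos x)\<^sup>2 = (k * (m * n + s))\<^sup>2" by simp
    moreover have "0 \<le> cg * cos x" "0 \<le> k * (m * n + s)"
      using cg cpos k s by (intro mult_nonneg_nonneg; linarith)+
    ultimately have "cg * cos x = k * (m * n + s)" by (rule power2_eq_imp_eq)
    then show "Re (e * cnj g) = m * cg * cos x \<and> Re (f * cnj g) = n * cg * cos x"
      unfolding eg fg by (metis mult.assoc mult.left_commute)
  qed
  show ?thesis
    unfolding x_def[symmetric] 1 2 unfolding m_def[symmetric] n_def[symmetric] by (rule 3)
qed

lemma bisects_angle_cvec:
  assumes N: "Im (cnj (a - p) * (b - p)) \<noteq> 0"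
  shows "bisects_angle L (cvec p) (cvec a) (cvec b) \<longleftrightarrow>
     cvec p \<in> L \<and> (\<exists>x. cvec x \<in> L \<and> bisector_point p a b x)"
proof -
  have bx: "x \<noteq> p \<and> angle_at (cvec p) (cvec a) (cvec x) = angle_at (cvec p) (cvec a) (cvec b) / 2 \<and>
     angle_at (cvec p) (cvec x) (cvec b) = angle_at (cvec p) (cvec a) (cvec b) / 2 \<longleftrightarrow> bisector_point p a b x" for x
  proof (cases "x = p")
    case True
    have "\<not> bisector_point p a b p"
    proof
      assume "bisector_point p a b p"
      then have "Re (cnj (p - a) * (p - p)) > 0" using bisector_inner_pos(1)[OF _ N] by blast
      then show False by simp
    qed
    then show ?thesis using True by blast
  next
    case False
    then have "x - p \<noteq> 0" by simp
    from half_angles_iff[OF N this] show ?thesis using False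
      unfolding angle_at_cvec bisector_point_def by blast
  qed
  show ?thesis
  proof
    assume "bisects_angle L (cvec p) (cvec a) (cvec b)"
    then obtain X where X: "cvec p \<in> L" "X \<in> L" "X \<noteq> cvec p"
      "angle_at (cvec p) (cvec a) X = angle_at (cvec p) (cvec a) (cvec b) / 2"
      "angle_at (cvec p) X (cvec b) = angle_at (cvec p) (cvec a) (cvec b) / 2"
      unfolding bisects_angle_def by blast
    obtain x where x: "X = cvec x" by (rule cvec_surj)
    then have "x \<noteq> p" using X by auto
    then have "bisector_point p a b x" using bx[of x] X unfolding x by blast
    then show "cvec p \<in> L \<and> (\<exists>x. cvec x \<in> L \<and> bisector_point p a b x)" using X x by blast
  next
    assume "cvec p \<in> L \<and> (\<exists>x. cvec x \<in> L \<and> bisector_point p a b x)"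
    then obtain x where x: "cvec p \<in> L" "cvec x \<in> L" "bisector_point p a b x" by blast
    then have y: "x \<noteq> p" "angle_at (cvec p) (cvec a) (cvec x) = angle_at (cvec p) (cvec a) (cvec b) / 2"
     "angle_at (cvec p) (cvec x) (cvec b) = angle_at (cvec p) (cvec a) (cvec b) / 2" using bx[of x] by auto
    then have "cvec x \<noteq> cvec p" by simp
    then show "bisects_angle L (cvec p) (cvec a) (cvec b)" unfolding bisects_angle_def using x y by blast
  qed
qed

subsection \<open>Three-periodics of the billiard\<close>

text \<open>The circumellipse in standard position: \<open>l = 1\<close>, centre at the origin,
  level one. The coefficients are the eigenvalues \<open>(3 - d) * (1 + d)\<close> and
  \<open>(3 + d) * (1 - d)\<close> of \<open>conic_map d 1\<close>.\<close>

definition billiard_ellipse :: "real \<Rightarrow> (real^2) set" where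
  "billiard_ellipse d = axis_ellipse (3 - d\<^sup>2 + 2 * d) (3 - d\<^sup>2 - 2 * d)"

lemma billiard_axes_pos:
  assumes "0 \<le> d" "d < 1"
  shows "3 - d\<^sup>2 + 2 * d > (0::real)" "3 - d\<^sup>2 - 2 * d > 0"
proof -
  have "d\<^sup>2 < 1" using assms by (simp add: power_less_one_iff)
  then show "3 - d\<^sup>2 + 2 * d > (0::real)" "3 - d\<^sup>2 - 2 * d > 0" using assms by linarith+
qed

lemma billiard_ellipse_iff:
  "cvec w \<in> billiard_ellipse d \<longleftrightarrow> Re (cnj w * conic_map d 1 w) = 1"
  unfolding billiard_ellipse_def axis_ellipse_def conic_map_def
  by (simp add: power2_eq_square algebra_simps)

lemma billiard_normal_iff:
  assumes "cvec w \<in> billiard_ellipse d" "0 \<le> d" "d < 1"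
  shows "cvec x \<in> normal_line (billiard_ellipse d) (cvec w) \<longleftrightarrow> Im (cnj (conic_map d 1 w) * (x - w)) = 0"
  unfolding billiard_ellipse_def normal_line_axis_ellipse[OF billiard_axes_pos[OF assms(2,3)] assms(1)[unfolded billiard_ellipse_def]]
  by (auto simp: conic_map_def algebra_simps)

definition billiard_bisected :: "real \<Rightarrow> complex \<Rightarrow> complex \<Rightarrow> complex \<Rightarrow> bool" where
  "billiard_bisected d p a b \<longleftrightarrow> (\<exists>x. Im (cnj (conic_map d 1 p) * (x - p)) = 0 \<and> bisector_point p a b x)"

text \<open>The quantifier in \<open>three_periodics\<close> runs over all orderings of the
  vertices; bisection is symmetric in the two sides, which leaves one condition per vertex.\<close>

lemma three_periodics_cvec:
  assumes d: "0 \<le> d" "d < 1"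
  shows "{cvec a, cvec b, cvec c} \<in> three_periodics (billiard_ellipse d) \<longleftrightarrow>
    Im (cnj (b - a) * (c - a)) \<noteq> 0 \<and> {cvec a, cvec b, cvec c} \<subseteq> billiard_ellipse d \<and>
    billiard_bisected d a b c \<and> billiard_bisected d b a c \<and> billiard_bisected d c a b" (is "?L \<longleftrightarrow> ?R")
proof -
  let ?E = "billiard_ellipse d"
  have bis: "bisects_angle (normal_line ?E (cvec p)) (cvec p) (cvec q) (cvec s) \<longleftrightarrow> billiard_bisected d p q s"
    if "Im (cnj (q - p) * (s - p)) \<noteq> 0" "cvec p \<in> ?E" for p q s
    unfolding bisects_angle_cvec[OF that(1)] billiard_normal_iff[OF that(2) d] billiard_bisected_def by simp
  show ?thesis
  proof
    assume ?L
    then have tri: "is_triangle {cvec a, cvec b, cvec c}" and sub: "{cvec a, cvec b, cvec c} \<subseteq> ?E"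
      and all: "\<And>P A B. {cvec a, cvec b, cvec c} = {P, A, B} \<Longrightarrow> bisects_angle (normal_line ?E P) P A B"
      unfolding three_periodics_def by auto
    have N: "Im (cnj (b - a) * (c - a)) \<noteq> 0" using tri unfolding is_triangle_cvec .
    have N2: "Im (cnj (a - b) * (c - b)) \<noteq> 0" "Im (cnj (a - c) * (b - c)) \<noteq> 0"
      using N by (simp_all add: algebra_simps)
    have "billiard_bisected d a b c" using bis[OF N] all sub by simp
    moreover have "billiard_bisected d b a c" using bis[OF N2(1)] all sub by (simp add: insert_commute)
    moreover have "billiard_bisected d c a b" using bis[OF N2(2)] all sub by (simp add: insert_commute)
    ultimately show ?R using N sub by blast
  next
    assume R: ?R
    then have N: "Im (cnj (b - a) * (c - a)) \<noteq> 0" and sub: "{cvec a, cvec b, cvec c} \<subseteq> ?E"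
      and bb: "billiard_bisected d a b c" "billiard_bisected d b a c" "billiard_bisected d c a b" by auto
    have bb': "billiard_bisected d a c b" "billiard_bisected d b c a" "billiard_bisected d c b a"
      using bb bisector_point_commute unfolding billiard_bisected_def by blast+
    have tri: "is_triangle {cvec a, cvec b, cvec c}" using N unfolding is_triangle_cvec .
    have "bisects_angle (normal_line ?E P) P A B" if eq: "{cvec a, cvec b, cvec c} = {P, A, B}" for P A B
    proof -
      obtain p where p: "P = cvec p" by (rule cvec_surj)
      obtain q where q: "A = cvec q" by (rule cvec_surj)
      obtain s where s: "B = cvec s" by (rule cvec_surj)
      have N': "Im (cnj (q - p) * (s - p)) \<noteq> 0" using tri unfolding eq p q s is_triangle_cvec .
      then have ne: "p \<noteq> q" "p \<noteq> s" "q \<noteq> s" by (auto simp: algebra_simps)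
      have "cvec p \<in> cvec ` {a, b, c}" "cvec q \<in> cvec ` {a, b, c}" "cvec s \<in> cvec ` {a, b, c}"
        using eq unfolding p q s by auto
      then have "p \<in> {a, b, c}" "q \<in> {a, b, c}" "s \<in> {a, b, c}" by (auto simp: image_iff)
      then have "billiard_bisected d p q s" using ne bb bb' by auto
      moreover have "cvec p \<in> ?E" using sub eq p by auto
      ultimately show ?thesis unfolding p q s using bis[OF N'] by blast
    qed
    then show ?L using tri sub unfolding three_periodics_def by blast
  qed
qed

lemma conic_map_rotate:
  assumes "m \<noteq> 0"
  shows "conic_map d 1 (m * w) = m * (complex_of_real (3 - d\<^sup>2) * w + (2 * d * (cnj m / m)) * cnj w)"
  using assms by (simp add: conic_map_def field_simps)

text \<open>The equation \<open>cnj m = l * m\<close> makes multiplication by \<open>m\<close> carry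
  \<open>conic_map d l\<close> to \<open>conic_map d 1\<close>, and \<open>K\<close> brings the
  level to one. Normals through the incentre and internal bisectors are preserved by the similarity
  \<open>f\<close>.\<close>

lemma billiard_three_periodicI:
  assumes p: "poncelet_triangle d l z1 z2 z3" and d: "0 \<le> d" "d < 1" and m: "m \<noteq> 0" "cnj m = l * m"
    and K: "(cmod m)\<^sup>2 * conic_level d l = 1"
  defines "f \<equiv> \<lambda>z. m * (z - conic_centre d l)"
  shows "{cvec (f z1), cvec (f z2), cvec (f z3)} \<in> three_periodics (billiard_ellipse d)"
proof -
  have z: "poncelet_root d l z1" "poncelet_root d l z2" "poncelet_root d l z3"
    and ne: "z1 \<noteq> z2" "z1 \<noteq> z3" "z2 \<noteq> z3" using p by (auto simp: poncelet_triangle_def)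
  have u: "cmod z1 = 1" "cmod z2 = 1" "cmod z3 = 1" using z by (auto simp: poncelet_root_def)
  define c where "c = conic_centre d l"
  have N: "conic_map d 1 (m * w) = m * conic_map d l w" for w :: complex
    unfolding conic_map_def complex_cnj_mult m(2) by (simp add: algebra_simps)
  have fd: "f y - f w = m * (y - w)" for y w :: complex by (simp add: f_def algebra_simps)
  have el: "cvec (f y) \<in> billiard_ellipse d" if y: "poncelet_root d l y" for y :: complex
  proof -
    have "Re (cnj (f y) * conic_map d 1 (f y)) = Re (complex_of_real ((cmod m)\<^sup>2) * (cnj (y - c) * conic_map d l (y - c)))"
      unfolding f_def N c_def complex_norm_square by (simp add: mult_ac)
    also have "\<dots> = (cmod m)\<^sup>2 * Re (cnj (y - c) * conic_map d l (y - c))"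
      by (simp only: Re_complex_of_real Im_complex_of_real times_complex.sel; simp)
    also have "\<dots> = 1" using conic_level_vertex[OF y d] K by (simp add: c_def)
    finally show ?thesis unfolding billiard_ellipse_iff .
  qed
  have nrm: "Im (cnj (conic_map d 1 (f y)) * (f d - f y)) = 0" if y: "poncelet_root d l y" for y :: complex
  proof -
    have g: "conic_map d 1 (f y) = m * (normal_factor d y * (y - d))"
      unfolding f_def N using conic_map_vertex(1)[OF y d] by simp
    have "cnj (conic_map d 1 (f y)) * (f d - f y) =
      - (normal_factor d y * ((m * cnj m) * ((y - d) * cnj (y - d))))"
      unfolding fd g by (simp add: algebra_simps)
    also have "\<dots> = complex_of_real (- (normal_factor d y * ((cmod m)\<^sup>2 * (cmod (y - d))\<^sup>2)))"
      unfolding complex_norm_square[symmetric] by simp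
    finally show ?thesis by (metis Im_complex_of_real)
  qed
  have fam: "scaled_triangle 1 z1 z2 z3 \<in> poristic_family 1 ((1 - d\<^sup>2) / 2)"
    using poristic_family_iff[of 1 d "(1 - d\<^sup>2) / 2"] p d by auto
  have inc: "poristic_incenter 1 ((1 - d\<^sup>2) / 2) = cvec d"
    using poristic_incenter_eq[of 1 d "(1 - d\<^sup>2) / 2"] d by simp
  have r: "(1 - d\<^sup>2) / 2 > 0" using d by (simp add: power_less_one_iff)
  have pb: "bisector_point a b e d" if "{cvec z1, cvec z2, cvec z3} = {cvec a, cvec b, cvec e}" for a b e
    using poristic_bisectors[OF fam _ r inc, of a b e] that by (simp add: scaled_triangle_def)
  have fb: "bisector_point (f a) (f b) (f e) (f d)" if "bisector_point a b e d" for a b e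
    using bisector_point_scale[OF m(1) that, of "- m * c"] by (simp add: f_def c_def algebra_simps)
  have b: "bisector_point (f z1) (f z2) (f z3) (f d)" "bisector_point (f z2) (f z1) (f z3) (f d)"
    "bisector_point (f z3) (f z1) (f z2) (f d)"
    by (intro fb pb; auto)+
  have "cnj (f z2 - f z1) * (f z3 - f z1) = complex_of_real ((cmod m)\<^sup>2) * (cnj (z2 - z1) * (z3 - z1))"
    unfolding fd complex_norm_square by (simp add: mult_ac)
  then have "Im (cnj (f z2 - f z1) * (f z3 - f z1)) = (cmod m)\<^sup>2 * Im (cnj (z2 - z1) * (z3 - z1))"
    by (simp only: Re_complex_of_real Im_complex_of_real times_complex.sel; simp)
  then have "Im (cnj (f z2 - f z1) * (f z3 - f z1)) \<noteq> 0"
    using unit_circle_not_collinear[OF u ne] m(1) by simp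
  then show ?thesis unfolding three_periodics_cvec[OF d] billiard_bisected_def
    using el z nrm[OF z(1)] nrm[OF z(2)] nrm[OF z(3)] b by blast
qed

section \<open>Reduction of an arbitrary 3-periodic to the unit circle\<close>

lemma circumcentre_exists:
  assumes N: "Im (cnj (b - a) * (c - a)) \<noteq> 0"
  obtains w where "cmod (a - w) = cmod (b - w)" "cmod (a - w) = cmod (c - w)"
proof -
  define e f where "e = b - a" and "f = c - a"
  define D where "D = Im (cnj e * f)"
  have D: "D \<noteq> 0" using N by (simp add: D_def e_def f_def)
  define x y where "x = (Im f * (cmod e)\<^sup>2 - Im e * (cmod f)\<^sup>2) / (2 * D)"
    and "y = (Re e * (cmod f)\<^sup>2 - Re f * (cmod e)\<^sup>2) / (2 * D)"
  have xy: "2 * D * x = Im f * (cmod e)\<^sup>2 - Im e * (cmod f)\<^sup>2" "2 * D * y = Re e * (cmod f)\<^sup>2 - Re f * (cmod e)\<^sup>2"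
    using D by (simp_all add: x_def y_def)
  have De: "D = Re e * Im f - Im e * Re f" by (simp add: D_def)
  have 1: "D * (2 * (x * Re e + y * Im e)) = D * (cmod e)\<^sup>2" using xy De by algebra
  have 2: "D * (2 * (x * Re f + y * Im f)) = D * (cmod f)\<^sup>2" using xy De by algebra
  have h: "cmod (Complex x y) = cmod (g - Complex x y)" if "2 * (x * Re g + y * Im g) = (cmod g)\<^sup>2" for g
  proof -
    have "(cmod (Complex x y))\<^sup>2 = (cmod (g - Complex x y))\<^sup>2"
      using that unfolding cmod_power2 by (simp add: power2_eq_square algebra_simps)
    then show ?thesis by (simp add: power2_eq_iff_nonneg)
  qed
  have "cmod (Complex x y) = cmod (e - Complex x y)" "cmod (Complex x y) = cmod (f - Complex x y)"
    using 1 2 D by (intro h; simp)+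
  moreover have "a - (a + Complex x y) = - Complex x y" "b - (a + Complex x y) = e - Complex x y"
    "c - (a + Complex x y) = f - Complex x y" by (simp_all add: e_def f_def)
  ultimately show thesis using that[of "a + Complex x y"] by (metis norm_minus_cancel)
qed

text \<open>The weights are the lengths of the opposite sides divided by the perimeter. Their
  positivity later places the incentre strictly inside the circumcircle.\<close>

lemma incentre_exists:
  assumes N: "Im (cnj (b - a) * (c - a)) \<noteq> 0"
  obtains x p q s where "bisector_point a b c x" "bisector_point b a c x" "bisector_point c a b x"
    "p > 0" "q > 0" "s > 0" "p + q + s = 1" "x = p *\<^sub>R a + q *\<^sub>R b + s *\<^sub>R c"
proof -
  have ne: "a \<noteq> b" "a \<noteq> c" "b \<noteq> c" using N by (auto simp: algebra_simps)
  define A B C where "A = cmod (c - b)" and "B = cmod (c - a)" and "C = cmod (b - a)"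
  have pos: "A > 0" "B > 0" "C > 0" using ne by (auto simp: A_def B_def C_def)
  define S where "S = A + B + C"
  have S: "S > 0" using pos by (simp add: S_def)
  define x where "x = (A / S) *\<^sub>R a + (B / S) *\<^sub>R b + (C / S) *\<^sub>R c"
  have one: "A / S + B / S + C / S = 1" using S by (simp add: S_def add_divide_distrib[symmetric])
  have sw: "cmod (a - b) = C" "cmod (a - c) = B" "cmod (b - c) = A" "cmod (c - b) = A" "cmod (c - a) = B" "cmod (b - a) = C"
    by (simp_all add: A_def B_def C_def norm_minus_commute)
  have "x - a = (1 / S) *\<^sub>R (B *\<^sub>R (b - a) + C *\<^sub>R (c - a))"
    "x - b = (1 / S) *\<^sub>R (A *\<^sub>R (a - b) + C *\<^sub>R (c - b))"
    "x - c = (1 / S) *\<^sub>R (A *\<^sub>R (a - c) + B *\<^sub>R (b - c))"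
  proof -
    have aa: "A / S = 1 - B / S - C / S" using one by linarith
    show "x - a = (1 / S) *\<^sub>R (B *\<^sub>R (b - a) + C *\<^sub>R (c - a))" unfolding x_def aa by (simp add: algebra_simps)
    have bb: "B / S = 1 - A / S - C / S" using one by linarith
    show "x - b = (1 / S) *\<^sub>R (A *\<^sub>R (a - b) + C *\<^sub>R (c - b))" unfolding x_def bb by (simp add: algebra_simps)
    have cc: "C / S = 1 - A / S - B / S" using one by linarith
    show "x - c = (1 / S) *\<^sub>R (A *\<^sub>R (a - c) + B *\<^sub>R (b - c))" unfolding x_def cc by (simp add: algebra_simps)
  qed
  moreover have "1 / S > 0" using S by simp
  ultimately have "bisector_point a b c x" "bisector_point b a c x" "bisector_point c a b x"
    unfolding bisector_point_def sw by blast+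
  then show thesis using that[of x "A / S" "B / S" "C / S"] one pos S x_def by simp
qed

lemma bisector_point_ray:
  assumes "bisector_point a b c x" "bisector_point a b c y"
  shows "\<exists>k>0. y - a = k *\<^sub>R (x - a)"
proof -
  obtain k j where k: "k > 0" "x - a = k *\<^sub>R (cmod (c - a) *\<^sub>R (b - a) + cmod (b - a) *\<^sub>R (c - a))"
    and j: "j > 0" "y - a = j *\<^sub>R (cmod (c - a) *\<^sub>R (b - a) + cmod (b - a) *\<^sub>R (c - a))"
    using assms unfolding bisector_point_def by blast
  have "y - a = (j / k) *\<^sub>R (x - a)" "j / k > 0" using k j by simp_all
  then show ?thesis by blast
qed

text \<open>The normal line and the internal bisector share the vertex and a further point, so they
  coincide, and the incentre lies on the normal.\<close>

lemma billiard_gradient_to_incentre: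
  assumes bb: "billiard_bisected d a b c" and x: "bisector_point a b c x" and N: "Im (cnj (b - a) * (c - a)) \<noteq> 0"
  shows "\<exists>k::real. conic_map d 1 a = k * (a - x)"
proof -
  obtain y where y: "Im (cnj (conic_map d 1 a) * (y - a)) = 0" "bisector_point a b c y"
    using bb unfolding billiard_bisected_def by blast
  obtain k where k: "k > 0" "y - a = k *\<^sub>R (x - a)" using bisector_point_ray[OF x y(2)] by blast
  define g where "g = conic_map d 1 a"
  have "Im (cnj g * (y - a)) = k * Im (cnj g * (x - a))" unfolding k(2) by (simp add: algebra_simps)
  then have "Im (cnj g * (x - a)) = 0" using y(1) k(1) by (simp add: g_def)
  then have im: "Im (g * cnj (a - x)) = 0" by (simp add: algebra_simps)
  have "Re (cnj (a - b) * (a - x)) > 0" using bisector_inner_pos(1)[OF x N] .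
  then have ne: "a - x \<noteq> 0" by auto
  have n: "(cmod (a - x))\<^sup>2 \<noteq> 0" using ne by simp
  define t where "t = Re (g * cnj (a - x)) / (cmod (a - x))\<^sup>2"
  have "g * cnj (a - x) = complex_of_real (Re (g * cnj (a - x)))"
    using im by (simp add: complex_eq_iff)
  also have "\<dots> = complex_of_real t * complex_of_real ((cmod (a - x))\<^sup>2)"
    unfolding of_real_mult[symmetric] using n by (simp add: t_def)
  also have "\<dots> = t * (a - x) * cnj (a - x)" unfolding complex_norm_square by simp
  finally have "g = t * (a - x)" using ne by simp
  then show ?thesis unfolding g_def by blast
qed

lemma convex_combination_Re_less_1:
  assumes u: "cmod z1 = 1" "cmod z2 = 1" "cmod z3 = 1" and ne: "z1 \<noteq> z2"
    and p: "p > 0" "q > 0" "s > 0" "p + q + s = 1"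
    and d: "complex_of_real d = p *\<^sub>R z1 + q *\<^sub>R z2 + s *\<^sub>R z3"
  shows "d < 1"
proof -
  have le: "Re z1 \<le> 1" "Re z2 \<le> 1" "Re z3 \<le> 1" using u complex_Re_le_cmod by metis+
  have one: "z = 1" if "cmod z = 1" "Re z = 1" for z
    using that cmod_power2[of z] by (simp add: complex_eq_iff)
  have lt: "Re z1 < 1 \<or> Re z2 < 1" using le one[OF u(1)] one[OF u(2)] ne by force
  have dd: "d = p * Re z1 + q * Re z2 + s * Re z3" using arg_cong[OF d, of Re] by simp
  have l: "p * Re z1 \<le> p" "q * Re z2 \<le> q" "s * Re z3 \<le> s" using le p by (simp_all add: mult_left_le)
  have "p * Re z1 < p \<or> q * Re z2 < q" using lt p by auto
  then show ?thesis using dd l p(4) by linarith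
qed

text \<open>The triangle itself supplies the coordinates: circumcentre at 0, circumradius 1,
  incentre at a real \<open>d'\<close> in [0,1). The pulled-back ellipse is identified by
  \<open>conic_uniqueness\<close>, and comparison of coefficients then gives
  \<open>d' = d\<close>.\<close>

lemma billiard_three_periodic_cases:
  assumes d: "0 \<le> d" "d < 1" and T: "T \<in> three_periodics (billiard_ellipse d)"
  obtains l z1 z2 z3 m where "poncelet_triangle d l z1 z2 z3" "m \<noteq> 0" "cnj m = l * m"
    "(cmod m)\<^sup>2 * conic_level d l = 1"
    "T = (\<lambda>z. cvec (m * (z - conic_centre d l))) ` {z1, z2, z3}"
proof -
  have "card T = 3" using T by (simp add: three_periodics_def is_triangle_def)
  then obtain a b c where abc: "T = {cvec a, cvec b, cvec c}" "a \<noteq> b" "a \<noteq> c" "b \<noteq> c"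
    using three_points_cvec by blast
  have N: "Im (cnj (b - a) * (c - a)) \<noteq> 0" and E: "cvec a \<in> billiard_ellipse d" "cvec b \<in> billiard_ellipse d" "cvec c \<in> billiard_ellipse d"
    and bb: "billiard_bisected d a b c" "billiard_bisected d b a c" "billiard_bisected d c a b"
    using T unfolding abc(1) three_periodics_cvec[OF d] by auto
  have N2: "Im (cnj (a - b) * (c - b)) \<noteq> 0" "Im (cnj (a - c) * (b - c)) \<noteq> 0"
      using N by (simp_all add: algebra_simps)
  obtain w where w: "cmod (a - w) = cmod (b - w)" "cmod (a - w) = cmod (c - w)"
    using circumcentre_exists[OF N] by blast
  define \<rho> where "\<rho> = cmod (a - w)"
  have \<rho>: "\<rho> > 0" unfolding \<rho>_def using w abc(2) by (metis eq_iff_diff_eq_0 norm_eq_zero right_minus_eq zero_less_norm_iff)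
  obtain x p q s where x: "bisector_point a b c x" "bisector_point b a c x" "bisector_point c a b x"
    and pqs: "p > 0" "q > 0" "s > 0" "p + q + s = 1" "x = p *\<^sub>R a + q *\<^sub>R b + s *\<^sub>R c"
    using incentre_exists[OF N] by blast
  \<comment> \<open>If the centres coincide they define no direction. The product of the unit
    vectors towards the vertices is then taken: with it \<open>l = e / e^3\<close>, so that
    \<open>l * e = cnj e\<close>, as the rotation condition demands.\<close>
  define e where "e = (if x = w then (a - w) * (b - w) * (c - w) / \<rho>^3 else sgn (x - w))"
  have e1: "cmod e = 1" using w \<rho> \<rho>_def by (simp add: e_def norm_mult norm_divide norm_power norm_sgn power3_eq_cube)
  then have e0: "e \<noteq> 0" by auto
  define d' where "d' = cmod (x - w) / \<rho>"
  define m where "m = \<rho> * e"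
  have m0: "m \<noteq> 0" using e0 \<rho> by (simp add: m_def)
  have cm: "cmod m = \<rho>" using e1 \<rho> by (simp add: m_def norm_mult)
  have xm: "x = m * d' + w"
  proof (cases "x = w")
    case False
    then have "e = (x - w) / cmod (x - w)" by (simp add: e_def sgn_eq)
    then show ?thesis using False \<rho> by (simp add: m_def d'_def)
  qed (simp add: d'_def)
  define z1 z2 z3 where "z1 = (a - w) / m" and "z2 = (b - w) / m" and "z3 = (c - w) / m"
  have z: "a = m * z1 + w" "b = m * z2 + w" "c = m * z3 + w" using m0 by (simp_all add: z1_def z2_def z3_def)
  have u: "cmod z1 = 1" "cmod z2 = 1" "cmod z3 = 1"
    using w \<rho> cm by (simp_all add: z1_def z2_def z3_def norm_divide \<rho>_def)
  have ne: "z1 \<noteq> z2" "z1 \<noteq> z3" "z2 \<noteq> z3" using abc z by auto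
  have pull: "bisector_point A B C (complex_of_real d')"
    if "bisector_point (m * A + w) (m * B + w) (m * C + w) (m * d' + w)" for A B C
    using bisector_point_scale[OF _ that, of "1 / m" "- w / m"] m0 by (simp add: field_simps)
  have b: "bisector_point z1 z2 z3 d'" "bisector_point z2 z1 z3 d'" "bisector_point z3 z1 z2 d'"
    using x unfolding z xm by (auto intro: pull)
  have d'0: "0 \<le> d'" using \<rho> by (simp add: d'_def)
  have d'1: "d' < 1"
  proof (rule convex_combination_Re_less_1[OF u ne(1) pqs(1-4)])
    have "m * d' + w = m * (p *\<^sub>R z1 + q *\<^sub>R z2 + s *\<^sub>R z3) + (p + q + s) *\<^sub>R w"
      using pqs(5) unfolding z xm by (simp add: algebra_simps)
    then show "complex_of_real d' = p *\<^sub>R z1 + q *\<^sub>R z2 + s *\<^sub>R z3" using m0 pqs(4) by simp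
  qed
  define c1 where "c1 = - w / m"
  \<comment> \<open>The pulled-back gradient map keeps its real coefficient and has \<open>M\<close>
    as the coefficient of the conjugate; \<open>c1\<close> is the preimage of the centre of the
    ellipse.\<close>
  define M where "M = 2 * d * (cnj m / m)"
  have az: "m * y + w = m * (y - c1)" for y using m0 by (simp add: c1_def field_simps)
  have grad: "\<exists>k::real. complex_of_real (3 - d\<^sup>2) * (y - c1) + M * cnj (y - c1) = k * (y - complex_of_real d')
      \<and> Re (cnj (y - c1) * (k * (y - complex_of_real d'))) = 1 / \<rho>\<^sup>2"
    if A: "cvec (m * y + w) \<in> billiard_ellipse d" "billiard_bisected d (m * y + w) B C"
      "bisector_point (m * y + w) B C x" "Im (cnj (B - (m * y + w)) * (C - (m * y + w))) \<noteq> 0" for y B C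
  proof -
    obtain k :: real where k: "conic_map d 1 (m * y + w) = k * (m * y + w - x)"
      using billiard_gradient_to_incentre[OF A(2,3,4)] by blast
    define G where "G = complex_of_real (3 - d\<^sup>2) * (y - c1) + M * cnj (y - c1)"
    have cg: "conic_map d 1 (m * y + w) = m * G" unfolding az conic_map_rotate[OF m0] G_def M_def by simp
    have "m * G = m * (k * (y - complex_of_real d'))" using k unfolding cg xm by (simp add: algebra_simps)
    then have G: "G = k * (y - complex_of_real d')" using m0 by simp
    have "Re (cnj (m * (y - c1)) * (m * G)) = 1" using A(1) unfolding billiard_ellipse_iff cg unfolding az .
    moreover have "cnj (m * (y - c1)) * (m * G) = complex_of_real (\<rho>\<^sup>2) * (cnj (y - c1) * G)"
      unfolding cm[symmetric] complex_norm_square by (simp add: mult_ac)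
    moreover have "Re (complex_of_real (\<rho>\<^sup>2) * (cnj (y - c1) * G)) = \<rho>\<^sup>2 * Re (cnj (y - c1) * G)"
      by (simp only: Re_complex_of_real Im_complex_of_real times_complex.sel; simp)
    ultimately have "\<rho>\<^sup>2 * Re (cnj (y - c1) * G) = 1" by metis
    then have "Re (cnj (y - c1) * G) = 1 / \<rho>\<^sup>2" using \<rho> by (simp add: field_simps del: times_complex.sel)
    then show ?thesis using G unfolding G_def[symmetric] by auto
  qed
  obtain k1 :: real where k1: "complex_of_real (3 - d\<^sup>2) * (z1 - c1) + M * cnj (z1 - c1) = k1 * (z1 - complex_of_real d')"
      "Re (cnj (z1 - c1) * (k1 * (z1 - complex_of_real d'))) = 1 / \<rho>\<^sup>2"
    using grad[of z1 b c] E bb x N z by metis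
  obtain k2 :: real where k2: "complex_of_real (3 - d\<^sup>2) * (z2 - c1) + M * cnj (z2 - c1) = k2 * (z2 - complex_of_real d')"
      "Re (cnj (z2 - c1) * (k2 * (z2 - complex_of_real d'))) = 1 / \<rho>\<^sup>2"
    using grad[of z2 a c] E bb x N2 z by metis
  obtain k3 :: real where k3: "complex_of_real (3 - d\<^sup>2) * (z3 - c1) + M * cnj (z3 - c1) = k3 * (z3 - complex_of_real d')"
      "Re (cnj (z3 - c1) * (k3 * (z3 - complex_of_real d'))) = 1 / \<rho>\<^sup>2"
    using grad[of z3 a b] E bb x N2 z by metis
  define l where "l = z1 * z2 * z3"
  have l1: "cmod l = 1" using u by (simp add: l_def norm_mult)
  have a0: "3 - d\<^sup>2 > 0" using billiard_axes_pos[OF d] d by linarith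
  note U = conic_uniqueness[OF u unit_circle_not_collinear[OF u ne] d'0 d'1 a0 b k1(1) k2(1) k3(1) k1(2) k2(2) k3(2), folded l_def]
  obtain \<sigma> where s: "\<sigma> > 0" "3 - d\<^sup>2 = \<sigma> * (3 - d'\<^sup>2)" "M = complex_of_real \<sigma> * (2 * d' * l)"
    "c1 = conic_centre d' l" "1 / \<rho>\<^sup>2 = \<sigma> * conic_level d' l"
    using U(1) by auto
  \<comment> \<open>Moduli of the conjugate coefficients compare \<open>d\<close> with
    \<open>d'\<close> independently of any rotation; elimination of \<sigma> with the real
    coefficients then leaves \<open>(d - d') * (3 + d * d') = 0\<close>.\<close>
  have "cmod M = 2 * d" using d m0 by (simp add: M_def norm_mult norm_divide)
  moreover have "cmod M = \<sigma> * (2 * d')" unfolding s(3) using s(1) d'0 l1 by (simp add: norm_mult)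
  ultimately have sd: "d = \<sigma> * d'" by simp
  have "d * (3 - d'\<^sup>2) = d' * (3 - d\<^sup>2)" using sd s(2) by algebra
  then have "(d - d') * (3 + d * d') = 0" by algebra
  moreover have "3 + d * d' > 0" using d d'0 by (simp add: add_pos_nonneg)
  ultimately have dd: "d' = d" by simp
  have s1: "\<sigma> = 1" using s(2) a0 unfolding dd by simp
  have ml: "cnj m = l * m"
  \<comment> \<open>For positive \<open>d\<close> the argument of \<open>M\<close> determines the
    rotation. For \<open>d = 0\<close> the coefficient \<open>M\<close> vanishes and the special
    choice of \<open>e\<close> takes over.\<close>
  proof (cases "d = 0")
    case False
    have "complex_of_real (2 * d) * (cnj m / m) = complex_of_real (2 * d) * l"
      using s(3) unfolding s1 dd M_def by simp
    moreover have "complex_of_real (2 * d) \<noteq> 0" using False by simp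
    ultimately have "cnj m / m = l" using mult_left_cancel by blast
    then show ?thesis using m0 by (simp add: field_simps)
  next
    case True
    then have "x = w" using dd xm by simp
    then have "e = (m * z1) * (m * z2) * (m * z3) / \<rho>^3" using z by (simp add: e_def)
    also have "\<dots> = e^3 * l" using \<rho> by (simp add: m_def l_def power3_eq_cube)
    finally have "e * (e * (e * l)) = e" by (simp add: power3_eq_cube mult_ac)
    then have "e * (e * l) = 1" using e0 by simp
    then have "cnj e * (e * (e * l)) = cnj e" by simp
    then have "e * l = cnj e" using unit_mult_cnj[OF e1] by (metis mult.assoc mult.commute mult.left_neutral)
    then show ?thesis by (simp add: m_def mult_ac)
  qed
  have K: "(cmod m)\<^sup>2 * conic_level d l = 1" using s(5) \<rho> unfolding s1 dd cm by (simp add: field_simps)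
  have pt: "poncelet_triangle d l z1 z2 z3" using U(2-4) ne unfolding dd poncelet_triangle_def by blast
  have "T = (\<lambda>z. cvec (m * (z - conic_centre d l))) ` {z1, z2, z3}"
    unfolding abc(1) z az s(4) dd by simp
  then show thesis using that[OF pt m0 ml K] by blast
qed

section \<open>Similarities as complex affine maps\<close>

definition similarity_map :: "complex \<Rightarrow> complex \<Rightarrow> real^2 \<Rightarrow> real^2" where
  "similarity_map m n X = cvec (m * Complex (X $ 1) (X $ 2) + n)"

lemma similarity_map_cvec [simp]: "similarity_map m n (cvec z) = cvec (m * z + n)"
  by (simp add: similarity_map_def complex_eq_iff)

lemma is_similarity_map:
  assumes "m \<noteq> 0"
  shows "is_similarity (similarity_map m n)"
proof -
  define k where "k = cmod m"
  have k: "k > 0" using assms by (simp add: k_def)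
  define p q where "p = Re m / k" and "q = Im m / k"
  have m: "Re m = k * p" "Im m = k * q" using k by (simp_all add: p_def q_def)
  have pq: "p * p + q * q = 1"
  proof -
    have "(k * p)\<^sup>2 + (k * q)\<^sup>2 = k\<^sup>2" using cmod_power2[of m] m by (simp add: k_def)
    then have "k\<^sup>2 * (p * p + q * q) = k\<^sup>2 * 1" by algebra
    then show ?thesis using k by simp
  qed
  define A :: "real^2^2" where "A = vector [vector [p, - q], vector [q, p]]"
  have "transpose A ** A = mat 1"
    using pq by (simp add: A_def vec_eq_iff forall_2 matrix_matrix_mult_def transpose_def sum_2 mat_def mult.commute)
  then have "orthogonal_matrix A" by (simp add: orthogonal_matrix)
  moreover have "det A = 1" using pq by (simp add: det_2 A_def)
  ultimately have A: "rotation_matrix A" by (simp add: rotation_matrix_def)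
  have "similarity_map m n = (\<lambda>x. k *\<^sub>R (A *v x) + cvec n)"
    by (rule ext) (simp add: similarity_map_def vec_eq_iff forall_2 A_def matrix_vector_mult_def sum_2 m algebra_simps)
  then show ?thesis unfolding is_similarity_def using k A by blast
qed

text \<open>A single vertex determines the level, since \<open>1 - d * z\<close> has no zero on the
  unit circle. A chosen level thus depends on the triangle only and is the same for t and t + 2
  pi.\<close>

lemma poncelet_triangle_level_unique:
  assumes "poncelet_triangle d l z1 z2 z3" "poncelet_triangle d m w1 w2 w3" "R \<noteq> 0" "0 \<le> d" "d < 1"
    and "scaled_triangle R z1 z2 z3 = scaled_triangle R w1 w2 w3"
  shows "l = m"
proof -
  have "cvec (R * z1) \<in> scaled_triangle R w1 w2 w3"
    unfolding assms(6)[symmetric] by (simp add: scaled_triangle_def)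
  then have "z1 \<in> {w1, w2, w3}" using assms(3) by (auto simp: scaled_triangle_def)
  then have "poncelet_root d m z1" using assms(2) by (auto simp: poncelet_triangle_def)
  then have "l * (1 - d * z1)\<^sup>2 = m * (1 - d * z1)\<^sup>2" "cmod z1 = 1"
    using assms(1) by (auto simp: poncelet_triangle_def poncelet_root_def)
  then show ?thesis using pole_and_centre_ne_0(1)[of z1 d] assms(4,5) by (metis mult_cancel_right power_not_zero)
qed

subsection \<open>Matching the two families\<close>

theorem theorem4:
  fixes R r :: real
  assumes "r > 0" and "R \<ge> 2 * r"
  shows "\<exists>(E :: (real^2) set) (S :: real \<Rightarrow> real^2 \<Rightarrow> real^2).
    is_ellipse E \<and> (\<forall>t. is_similarity (S t)) \<and>
    {S t ` poristic_triangle R r t | t. True} = three_periodics E"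
proof -
  \<comment> \<open>The distance of the centres in units of \<open>R\<close>. The root is real
    because \<open>R\<close> is at least \<open>2 * r\<close>, and \<open>r > 0\<close> gives
    \<open>d < 1\<close>.\<close>
  define d where "d = sqrt (1 - 2 * r / R)"
  have R: "R > 0" using assms by linarith
  have rR: "0 \<le> 1 - 2 * r / R" "1 - 2 * r / R < 1" using assms R by (simp_all add: field_simps)
  have d: "0 \<le> d" "d < 1" using rR unfolding d_def by (simp_all add: real_sqrt_less_iff[of _ 1, simplified])
  have d2: "d\<^sup>2 = 1 - 2 * r / R" using rR by (simp add: d_def)
  have r: "r = R * (1 - d\<^sup>2) / 2" unfolding d2 using R by simp
  define E where "E = billiard_ellipse d"
  define \<Delta> where "\<Delta> = poristic_triangle R r"
  define lev where "lev t = (SOME l. \<exists>z1 z2 z3. poncelet_triangle d l z1 z2 z3 \<and> \<Delta> t = scaled_triangle R z1 z2 z3)" for t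
  \<comment> \<open>A square root of the level whose sign alternates with the full turns of t; the
    jump of \<open>csqrt\<close> does no harm.\<close>
  define om where "om t = (if even \<lfloor>t / (2 * pi)\<rfloor> then 1 else - 1) * csqrt (lev t)" for t
  \<comment> \<open>The conjugate root satisfies \<open>cnj (mu t) = lev t * mu t\<close>, and the
    divisor produces level one.\<close>
  define mu where "mu t = cnj (om t) / sqrt (conic_level d (lev t))" for t
  \<comment> \<open>The division by \<open>R\<close> undoes the scale of the poristic triangle; the
    translation moves the centre of its circumellipse to the origin.\<close>
  define S where "S t = similarity_map (mu t / R) (- mu t * conic_centre d (lev t))" for t
  have lev: "\<exists>z1 z2 z3. poncelet_triangle d (lev t) z1 z2 z3 \<and> \<Delta> t = scaled_triangle R z1 z2 z3" for t
    unfolding lev_def by (rule someI_ex) (use poristic_triangle_in_family[OF R d r] in \<open>simp add: \<Delta>_def\<close>)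
  have lev_eq: "lev t = l" if "poncelet_triangle d l z1 z2 z3" "\<Delta> t = scaled_triangle R z1 z2 z3" for t l z1 z2 z3
  proof -
    obtain w1 w2 w3 where w: "poncelet_triangle d (lev t) w1 w2 w3" "\<Delta> t = scaled_triangle R w1 w2 w3"
      using lev[of t] by blast
    show ?thesis by (rule poncelet_triangle_level_unique[OF w(1) that(1) _ d, of R]) (use R w(2) that(2) in auto)
  qed
  have unit: "cmod l = 1" if "poncelet_triangle d l z1 z2 z3" for l z1 z2 z3
    using conic_map_vertex(2)[OF _ d] that unfolding poncelet_triangle_def by blast
  have lev1: "cmod (lev t) = 1" for t using lev[of t] unit by blast
  have K: "conic_level d (lev t) > 0" for t using conic_level_pos[OF lev1 d] .
  have om2: "(om t)\<^sup>2 = lev t" for t by (simp add: om_def)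
  have om1: "cmod (om t) = 1" for t
    using arg_cong[OF om2[of t], of cmod] lev1[of t] by (simp add: norm_power power2_eq_1_iff) (smt (verit) norm_ge_zero)
  have mu: "mu t \<noteq> 0" "cnj (mu t) = lev t * mu t" "(cmod (mu t))\<^sup>2 * conic_level d (lev t) = 1" for t
  proof -
    show "mu t \<noteq> 0" using om1[of t] K[of t] by (auto simp: mu_def)
    have "om t = (om t)\<^sup>2 * cnj (om t)" using unit_mult_cnj[OF om1[of t]] by (simp add: power2_eq_square mult.assoc)
    then show "cnj (mu t) = lev t * mu t" unfolding mu_def om2 by simp
    have "cmod (mu t) = 1 / sqrt (conic_level d (lev t))" using om1[of t] K[of t] by (simp add: mu_def norm_divide)
    then show "(cmod (mu t))\<^sup>2 * conic_level d (lev t) = 1" using K[of t] by (simp add: power_divide)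
  qed
  have S_vertex: "S t (cvec (R * z)) = cvec (mu t * (z - conic_centre d (lev t)))" for t and z :: complex
    using R by (simp add: S_def algebra_simps)
  have image: "S t ` \<Delta> t = (\<lambda>z. cvec (mu t * (z - conic_centre d (lev t)))) ` {z1, z2, z3}"
    if "\<Delta> t = scaled_triangle R z1 z2 z3" for t z1 z2 z3
    unfolding that scaled_triangle_def by (simp add: S_vertex)
  have "{S t ` \<Delta> t | t. True} = three_periodics E"
  proof (intro equalityI subsetI)
    fix T assume "T \<in> {S t ` \<Delta> t | t. True}"
    then obtain t where T: "T = S t ` \<Delta> t" by blast
    obtain z1 z2 z3 where z: "poncelet_triangle d (lev t) z1 z2 z3" "\<Delta> t = scaled_triangle R z1 z2 z3"
      using lev[of t] by blast
    show "T \<in> three_periodics E"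
      using billiard_three_periodicI[OF z(1) d mu] unfolding T image[OF z(2)] E_def by simp
  next
    fix T assume "T \<in> three_periodics E"
    then obtain l z1 z2 z3 m where p: "poncelet_triangle d l z1 z2 z3" and m: "m \<noteq> 0" "cnj m = l * m"
      "(cmod m)\<^sup>2 * conic_level d l = 1" and T: "T = (\<lambda>z. cvec (m * (z - conic_centre d l))) ` {z1, z2, z3}"
      using billiard_three_periodic_cases[OF d] unfolding E_def by metis
    obtain t where t: "0 \<le> t" "t < 2 * pi" "\<Delta> t = scaled_triangle R z1 z2 z3"
      using poristic_triangle_surj[OF R d r p] unfolding \<Delta>_def by metis
    have t': "\<Delta> (t + 2 * pi) = scaled_triangle R z1 z2 z3"
      using t(3) poristic_triangle_periodic unfolding \<Delta>_def by simp
    have l: "lev t = l" "lev (t + 2 * pi) = l" using lev_eq[OF p t(3)] lev_eq[OF p t'] by auto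
    \<comment> \<open>The parameters t and t + 2 pi have turn counts 0 and 1, so both square roots
      are used for the same triangle.\<close>
    have "\<lfloor>t / (2 * pi)\<rfloor> = 0" using t(1,2) by (simp add: floor_eq_iff)
    moreover have "(t + 2 * pi) / (2 * pi) = t / (2 * pi) + 1" by (simp add: add_divide_distrib)
    ultimately have "om (t + 2 * pi) = - om t" unfolding om_def l by simp
    then have neg: "mu (t + 2 * pi) = - mu t" unfolding mu_def l by simp
    \<comment> \<open>The modulus of \<open>m\<close> is fixed by the level, and |m|^2 = m cnj m = l
      m^2, so the square of \<open>m\<close> depends on \<open>l\<close> only.\<close>
    have "m\<^sup>2 = (mu t)\<^sup>2"
    proof -
      have "conic_level d l > 0" using K[of t] l by simp
      then have "(cmod m)\<^sup>2 = (cmod (mu t))\<^sup>2" using m(3) mu(3)[of t] unfolding l by (metis less_irrefl mult_cancel_right)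
      then have "m * (l * m) = mu t * (l * mu t)"
        using complex_norm_square[of m] complex_norm_square[of "mu t"] m(2) mu(2)[of t] unfolding l by metis
      moreover have "l \<noteq> 0" using unit[OF p] by auto
      ultimately show ?thesis by (simp add: power2_eq_square)
    qed
    then have "m = mu t \<or> m = mu (t + 2 * pi)" unfolding neg by (simp add: power2_eq_iff)
    then have "T = S t ` \<Delta> t \<or> T = S (t + 2 * pi) ` \<Delta> (t + 2 * pi)"
      unfolding T image[OF t(3)] image[OF t'] l by auto
    then show "T \<in> {S t ` \<Delta> t | t. True}" by blast
  qed
  moreover have "is_ellipse E"
    unfolding E_def billiard_ellipse_def using is_ellipse_axis_ellipse billiard_axes_pos[OF d] by blast
  moreover have "is_similarity (S t)" for t
    unfolding S_def using is_similarity_map mu(1)[of t] R by simp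
  ultimately show ?thesis unfolding \<Delta>_def by blast
qed

end
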